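(* Consider $G=\mathrm{Aff}_+(\mathbb R)$ with a left-invariant Lorentzian structure (and left-invariant time orientation) given by a matrix $A=\begin{pmatrix}a&b\\c&d\end{pmatrix}$, $|A|>0$. (1) The Lie algebra of complete Killing vector fields is $ci(G)=\operatorname{span}(\widetilde X_1,\widetilde X_2)$. (2) The connected component of the identity of the isometry group is $I_0(\mathrm{Aff}_+(\mathbb R))=\{L_q: q\in\mathrm{Aff}_+(\mathbb R)\}\cong\mathrm{Aff}_+(\mathbb R)$.
   Context: $G=\mathrm{Aff}_+(\mathbb R)=\{(x,y)\in\mathbb R^2: y>0\}$ with product $(x_2,y_2)\cdot(x_1,y_1)=(x_2+y_2x_1,\,y_2y_1)$; left-invariant frame $X_1=y\,\partial_x$, $X_2=y\,\partial_y$; $L_q:\bar q\mapsto q\bar q$ is the left translation. $\widetilde X_1=\partial_x$, $\widetilde X_2=x\,\partial_x+y\,\partial_y$ (right-invariant fields). A real matrix $A=\begin{pmatrix}a&b\\c&d\end{pmatrix}$ with $|A|=ad-bc>0$ determines the left-invariant Lorentzian form $g(u_1X_1+u_2X_2)=-v_1^2+v_2^2$, $v_1=au_1+bu_2$, $v_2=cu_1+du_2$, with time orientation in which future directed nonspacelike vectors are those with $v_1\ge|v_2|$. Every left-invariant Lorentzian structure with left-invariant time orientation arises this way. A vector field $X$ is Killing if $L_Xg=0$ (Lie derivative); $ci(G)$ is the Lie algebra of complete Killing vector fields on $G$. An isometry of $G$ is a mapping $G\to G$ preserving the Lorentzian distance $d$, where $d(q_0,q_1)$ is the supremum of lengths $\int\sqrt{v_1^2-v_2^2}\,dt$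 of Lipschitz future directed nonspacelike curves from $q_0$ to $q_1$ (and $0$ if there are none). The isometries of $G$ form a Lie group $I(G)$ and $I_0(G)$ is its connected component of the identity.
   Formalization: Isometries are required to be bijections of G preserving the Lorentzian distance, not arbitrary mappings: in the flat case with lightlike X_1 (e.g. a=c) there are distance-preserving maps that are not onto, connected to the identity, and not left translations, so isometries would not form a group. *)

theory Defs
  imports "HOL-Analysis.Analysis" "HOL-Algebra.Bij"
begin

text \<open>
  Maps and vector fields on the open half-plane are total functions on \<^typ>\<open>real \<times> real\<close>;
  extensionality (the value \<^const>\<open>undefined\<close> off the half-plane) makes equality of such
  functions coincide with equality of the maps and fields they represent.
\<close>

definition aff_plus :: "(real \<times> real) set" where
  "aff_plus = {p. snd p > 0}"

definition aff_mult :: "real \<times> real \<Rightarrow> real \<times> real \<Rightarrow> real \<times> real" where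
  "aff_mult q p = (fst q + snd q * fst p, snd q * snd p)"

definition aff_group :: "(real \<times> real) monoid" where
  "aff_group = \<lparr>carrier = aff_plus, mult = aff_mult, one = (0, 1)\<rparr>"

definition left_translation :: "real \<times> real \<Rightarrow> real \<times> real \<Rightarrow> real \<times> real" where
  "left_translation q = (\<lambda>p\<in>aff_plus. aff_mult q p)"


definition right_field1 :: "real \<times> real \<Rightarrow> real \<times> real" where
  "right_field1 q = (1, 0)"

definition right_field2 :: "real \<times> real \<Rightarrow> real \<times> real" where
  "right_field2 q = (fst q, snd q)"

definition field_span ::
  "(real \<times> real \<Rightarrow> real \<times> real) \<Rightarrow> (real \<times> real \<Rightarrow> real \<times> real) \<Rightarrow>
   (real \<times> real \<Rightarrow> real \<times> real) set" where
  "field_span X Y = {(\<lambda>q\<in>aff_plus. \<alpha> *\<^sub>R X q + \<beta> *\<^sub>R Y q) | \<alpha> \<beta>. True}"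


text \<open>
  The tangent vector \<open>w\<close> at \<open>q = (x, y)\<close> equals \<open>u\<^sub>1 X\<^sub>1 + u\<^sub>2 X\<^sub>2\<close> for the left-invariant frame
  \<open>X\<^sub>1 = y \<partial>\<^sub>x\<close>, \<open>X\<^sub>2 = y \<partial>\<^sub>y\<close>, so \<open>u = w / y\<close>; the function below returns \<open>v = A u\<close>.
\<close>

definition frame_vec :: "real^2^2 \<Rightarrow> real \<times> real \<Rightarrow> real \<times> real \<Rightarrow> real^2" where
  "frame_vec A q w = A *v vector [fst w / snd q, snd w / snd q]"

text \<open>The polarization of the quadratic form \<open>- v\<^sub>1\<^sup>2 + v\<^sub>2\<^sup>2\<close>.\<close>

definition metric :: "real^2^2 \<Rightarrow> real \<times> real \<Rightarrow> real \<times> real \<Rightarrow> real \<times> real \<Rightarrow> real" where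
  "metric A q w w' =
     - (frame_vec A q w $ 1 * frame_vec A q w' $ 1) + frame_vec A q w $ 2 * frame_vec A q w' $ 2"

definition future_nonspacelike :: "real^2^2 \<Rightarrow> real \<times> real \<Rightarrow> real \<times> real \<Rightarrow> bool" where
  "future_nonspacelike A q w \<longleftrightarrow> frame_vec A q w $ 1 \<ge> \<bar>frame_vec A q w $ 2\<bar>"


text \<open>For an open set \<open>S\<close> in a finite-dimensional space this is the usual class \<open>C\<^sup>k\<close>.\<close>

primrec Ck_on :: "nat \<Rightarrow> 'a::real_normed_vector set \<Rightarrow> ('a \<Rightarrow> 'b::real_normed_vector) \<Rightarrow> bool" where
  "Ck_on 0 S f \<longleftrightarrow> continuous_on S f"
| "Ck_on (Suc k) S f \<longleftrightarrow>
     (\<forall>x\<in>S. f differentiable (at x)) \<and> (\<forall>v. Ck_on k S (\<lambda>x. frechet_derivative f (at x) v))"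

definition smooth_on :: "'a::real_normed_vector set \<Rightarrow> ('a \<Rightarrow> 'b::real_normed_vector) \<Rightarrow> bool" where
  "smooth_on S f \<longleftrightarrow> (\<forall>k. Ck_on k S f)"

definition lie_bracket ::
  "(real \<times> real \<Rightarrow> real \<times> real) \<Rightarrow> (real \<times> real \<Rightarrow> real \<times> real) \<Rightarrow> real \<times> real \<Rightarrow> real \<times> real" where
  "lie_bracket X V q =
     frechet_derivative V (at q) (X q) - frechet_derivative X (at q) (V q)"

text \<open>\<open>(L\<^sub>X g)(V, W) = X (g(V, W)) - g([X, V], W) - g(V, [X, W])\<close>.\<close>

definition lie_derivative_metric ::
  "real^2^2 \<Rightarrow> (real \<times> real \<Rightarrow> real \<times> real) \<Rightarrow> (real \<times> real \<Rightarrow> real \<times> real) \<Rightarrow>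
   (real \<times> real \<Rightarrow> real \<times> real) \<Rightarrow> real \<times> real \<Rightarrow> real" where
  "lie_derivative_metric A X V W q =
     frechet_derivative (\<lambda>p. metric A p (V p) (W p)) (at q) (X q)
     - metric A q (lie_bracket X V q) (W q) - metric A q (V q) (lie_bracket X W q)"

definition killing_field :: "real^2^2 \<Rightarrow> (real \<times> real \<Rightarrow> real \<times> real) \<Rightarrow> bool" where
  "killing_field A X \<longleftrightarrow> smooth_on aff_plus X \<and>
     (\<forall>V W. smooth_on aff_plus V \<longrightarrow> smooth_on aff_plus W \<longrightarrow>
        (\<forall>q\<in>aff_plus. lie_derivative_metric A X V W q = 0))"

definition complete_field :: "(real \<times> real \<Rightarrow> real \<times> real) \<Rightarrow> bool" where
  "complete_field X \<longleftrightarrow> (\<forall>q\<in>aff_plus. \<exists>\<gamma>::real \<Rightarrow> real \<times> real. \<gamma> 0 = q \<and>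
     (\<forall>t. \<gamma> t \<in> aff_plus \<and> (\<gamma> has_vector_derivative X (\<gamma> t)) (at t)))"

definition complete_killing_fields :: "real^2^2 \<Rightarrow> (real \<times> real \<Rightarrow> real \<times> real) set" where
  "complete_killing_fields A =
     {X \<in> extensional aff_plus. killing_field A X \<and> complete_field X}"


text \<open>
  Lipschitz curves on a compact interval with respect to the Euclidean distance and with respect
  to any Riemannian distance on the half-plane are the same, since their images are compact.
\<close>

definition admissible_curve ::
  "real^2^2 \<Rightarrow> real \<times> real \<Rightarrow> real \<times> real \<Rightarrow> real \<Rightarrow> (real \<Rightarrow> real \<times> real) \<Rightarrow> bool" where
  "admissible_curve A p q T \<gamma> \<longleftrightarrow>
     0 \<le> T \<and> \<gamma> ` {0..T} \<subseteq> aff_plus \<and> \<gamma> 0 = p \<and> \<gamma> T = q \<and>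
     (\<exists>C. C-lipschitz_on {0..T} \<gamma>) \<and>
     (AE t in lebesgue. t \<in> {0..T} \<longrightarrow>
        \<gamma> differentiable (at t within {0..T}) \<and>
        future_nonspacelike A (\<gamma> t) (vector_derivative \<gamma> (at t within {0..T})))"

definition curve_length :: "real^2^2 \<Rightarrow> real \<Rightarrow> (real \<Rightarrow> real \<times> real) \<Rightarrow> ennreal" where
  "curve_length A T \<gamma> = (\<integral>\<^sup>+ t\<in>{0..T}.
     ennreal (let v = frame_vec A (\<gamma> t) (vector_derivative \<gamma> (at t within {0..T}))
              in sqrt ((v $ 1)\<^sup>2 - (v $ 2)\<^sup>2)) \<partial>lebesgue)"

text \<open>The supremum may be infinite; over the empty set it is \<open>0\<close> in \<^typ>\<open>ennreal\<close>.\<close>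

definition lorentz_dist :: "real^2^2 \<Rightarrow> real \<times> real \<Rightarrow> real \<times> real \<Rightarrow> ennreal" where
  "lorentz_dist A p q = Sup {curve_length A T \<gamma> | T \<gamma>. admissible_curve A p q T \<gamma>}"


text \<open>
  Bijectivity has to be demanded for the isometries to form a group: if \<open>X\<^sub>1\<close> is lightlike, the
  surface is isometric to a half-plane of the Minkowski plane bounded by a lightlike line, and
  translations into its interior preserve the distance without being onto.
\<close>

definition isometries :: "real^2^2 \<Rightarrow> (real \<times> real \<Rightarrow> real \<times> real) set" where
  "isometries A = {f \<in> Bij aff_plus.
     \<forall>p\<in>aff_plus. \<forall>q\<in>aff_plus. lorentz_dist A (f p) (f q) = lorentz_dist A p q}"

definition isometry_group :: "real^2^2 \<Rightarrow> (real \<times> real \<Rightarrow> real \<times> real) monoid" where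
  "isometry_group A = BijGroup aff_plus \<lparr>carrier := isometries A\<rparr>"

text \<open>The topology of the Lie group of isometries is the compact-open topology.\<close>

definition isometry_topology :: "real^2^2 \<Rightarrow> (real \<times> real \<Rightarrow> real \<times> real) topology" where
  "isometry_topology A = subtopology
     (topology_generated_by
        {{f. f ` K \<subseteq> U} | K U. compact K \<and> K \<subseteq> aff_plus \<and> open U})
     (isometries A)"

definition isometries0 :: "real^2^2 \<Rightarrow> (real \<times> real \<Rightarrow> real \<times> real) set" where
  "isometries0 A = connected_component_of_set (isometry_topology A) \<one>\<^bsub>isometry_group A\<^esub>"

definition isometry_group0 :: "real^2^2 \<Rightarrow> (real \<times> real \<Rightarrow> real \<times> real) monoid" where
  "isometry_group0 A = isometry_group A \<lparr>carrier := isometries0 A\<rparr>"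

text \<open>
  A homeomorphic isomorphism of Lie groups is automatically a diffeomorphism, so isomorphism
  of Lie groups is expressed through the topology.
\<close>

definition lie_group_iso ::
  "('a, 'm) monoid_scheme \<Rightarrow> 'a topology \<Rightarrow> ('b, 'n) monoid_scheme \<Rightarrow> 'b topology \<Rightarrow>
   ('a \<Rightarrow> 'b) \<Rightarrow> bool" where
  "lie_group_iso G S H T \<phi> \<longleftrightarrow> \<phi> \<in> iso G H \<and> homeomorphic_map S T \<phi>"

end

theory Submission
  imports Defs
begin

text \<open>
  The idea is to work in null coordinates. The linear functions \<open>\<xi>\<close> and \<open>\<eta>\<close> on the plane that
  induce \<open>y * (v\<^sub>1 - v\<^sub>2)\<close> and \<open>y * (v\<^sub>1 + v\<^sub>2)\<close> turn the group into the half-plane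
  \<open>\<alpha> * \<eta> + \<beta> * \<xi> > 0\<close>, with height \<open>y = \<alpha> * \<eta> + \<beta> * \<xi>\<close>, metric \<open>- d\<xi> d\<eta> / y\<^sup>2\<close> and future cone
  \<open>d\<xi>, d\<eta> \<ge> 0\<close>. The signs of \<open>\<alpha>\<close> and \<open>\<beta>\<close> distinguish the flat, de Sitter and anti-de Sitter cases,
  but most of the argument does not depend on them. Left translations are the maps
  \<open>p \<mapsto> c *\<^sub>R p + v\<close> with \<open>c > 0\<close> and \<open>v\<close> parallel to the boundary, and the right-invariant fields generate
  them.

  Killing fields. A Killing field is conformal, so its null components have the form \<open>f \<xi>\<close> and
  \<open>g \<eta>\<close> (\<open>killing_field_separates\<close>). The remaining equation
  \<open>(f' + g') * y = 2 * (\<beta> * f + \<alpha> * g)\<close> forces \<open>f\<close> and \<open>g\<close> to be quadratic polynomials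
  (\<open>killing_component_quadratic\<close>). Along an integral curve \<open>\<xi>\<close> and \<open>\<eta>\<close> then satisfy Riccati
  equations, and a nonzero quadratic coefficient makes solutions blow up. Only the affine fields
  remain, and these are the right-invariant ones.

  Isometries. A bijection that preserves the distance preserves the relation of positive distance,
  which is the strict product order in \<open>(\<xi>, \<eta>)\<close> (\<open>lorentz_dist_pos_iff\<close>). Hence it maps null lines to
  null lines, and by a connectedness argument the elements of the identity component keep the two
  families of null lines apart (\<open>isometries0_preserve_null_coords\<close>). They are therefore of the form
  \<open>(\<xi>, \<eta>) \<mapsto> (\<phi> \<xi>, \<psi> \<eta>)\<close> with increasing homeomorphisms. No smoothness is given. But on a small
  rectangle with sides \<open>h\<close> and \<open>k\<close> the distance between opposite corners is close to
  \<open>sqrt (h * k) / y\<close> (\<open>lorentz_dist_rectangle\<close>), and comparison with the image rectangle yields both the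
  differentiability of \<open>\<phi>\<close> and \<open>\<psi>\<close> and the equation
  \<open>\<phi>' * \<psi>' * y\<^sup>2 = (\<alpha> * \<psi> + \<beta> * \<phi>)\<^sup>2\<close>. Its solutions are projective maps of the line, and those that
  map the range of the coordinate onto itself are affine (\<open>conformal_factor_preserving_is_homothety\<close>). So the identity component consists of left
  translations, and conversely the connected group of left translations is contained in it.
\<close>

section \<open>Almost everywhere differentiable functions and limits of products\<close>

text \<open>
  The fundamental theorem of calculus with exceptional null set. The difference quotients of a
  Lipschitz function are bounded by its Lipschitz constant, so dominated convergence applies to
  them; their integrals are difference quotients of an antiderivative \<open>H\<close> of the function at the
  two end points.
\<close>

lemma has_integral_derivative_lipschitz:
  fixes g g' :: "real \<Rightarrow> real"
  assumes lip: "C-lipschitz_on {a..b} g" and ab: "a \<le> b"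
    and deriv: "AE t in lebesgue. t \<in> {a..b} \<longrightarrow>
      (g has_real_derivative g' t) (at t within {a..b})"
  shows "(g' has_integral g b - g a) {a..b}"
proof -
  \<comment> \<open>A continuous extension beyond \<open>b\<close>, where forward difference quotients still reach.\<close>
  define h where "h t = g (max a (min b t))" for t
  have C0: "C \<ge> 0" using lip lipschitz_on_nonneg by blast
  have h_lip: "\<bar>h s - h t\<bar> \<le> C * \<bar>s - t\<bar>" for s t
  proof -
    have "\<bar>h s - h t\<bar> \<le> C * \<bar>max a (min b s) - max a (min b t)\<bar>"
      using lipschitz_onD[OF lip, of "max a (min b s)" "max a (min b t)"] ab
      by (simp add: h_def dist_real_def)
    also have "\<dots> \<le> C * \<bar>s - t\<bar>"
      by (intro mult_left_mono C0) linarith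
    finally show ?thesis .
  qed
  have "C-lipschitz_on UNIV h"
    using h_lip C0 by (auto intro!: lipschitz_onI simp: dist_real_def)
  then have h_cont: "continuous_on UNIV h"
    using lipschitz_on_continuous_on by blast
  define H where "H t = integral {a..t} h" for t
  have H_deriv: "(H has_real_derivative h t) (at t within {a..b+1})" if "t \<in> {a..b+1}" for t
    unfolding H_def using integral_has_real_derivative[of a "b+1" h t] that h_cont
    by (auto intro: continuous_on_subset)
  define \<epsilon> where "\<epsilon> n = 1 / (real n + 1)" for n
  have \<epsilon>: "\<epsilon> n > 0" "\<epsilon> n \<le> 1" for n by (auto simp: \<epsilon>_def)
  have \<epsilon>_ne: "\<epsilon> n \<noteq> 0" for n using \<epsilon>(1)[of n] by simp
  have \<epsilon>_lim: "\<epsilon> \<longlonglongrightarrow> 0" unfolding \<epsilon>_def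
    using LIMSEQ_inverse_real_of_nat by (simp add: inverse_eq_divide add.commute)
  define Q where "Q n t = (h (t + \<epsilon> n) - h t) / \<epsilon> n" for n t
  define K where "K n t = (H (t + \<epsilon> n) - H t) / \<epsilon> n" for n t
  have Q_int: "(Q n has_integral K n b - K n a) {a..b}" for n
  proof (rule fundamental_theorem_of_calculus[OF ab])
    fix t assume t: "t \<in> {a..b}"
    have 1: "(H has_real_derivative h (t + \<epsilon> n)) (at (t + \<epsilon> n) within (\<lambda>t. t + \<epsilon> n) ` {a..b})"
      by (rule DERIV_subset[OF H_deriv]) (use t \<epsilon>[of n] in auto)
    have 2: "((\<lambda>t. t + \<epsilon> n) has_real_derivative 1) (at t within {a..b})"
      by (auto intro!: derivative_eq_intros)
    have 3: "((\<lambda>t. H (t + \<epsilon> n)) has_real_derivative h (t + \<epsilon> n)) (at t within {a..b})"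
      using DERIV_image_chain[OF 1 2] by (simp add: o_def)
    have 4: "(H has_real_derivative h t) (at t within {a..b})"
      by (rule DERIV_subset[OF H_deriv]) (use t in auto)
    have "(K n has_real_derivative Q n t) (at t within {a..b})"
      unfolding K_def[abs_def] Q_def
      by (rule DERIV_cdivide[OF DERIV_diff[OF 3 4]])
    then show "(K n has_vector_derivative Q n t) (at t within {a..b})"
      by (simp add: has_real_derivative_iff_has_vector_derivative)
  qed
  have quot: "(\<lambda>n. (F (t + \<epsilon> n) - F t) / \<epsilon> n) \<longlonglongrightarrow> D"
    if "(F has_real_derivative D) (at t within S)" "\<And>n. n \<ge> N \<Longrightarrow> t + \<epsilon> n \<in> S" for F :: "real \<Rightarrow> real" and D t S N
  proof -
    have "((\<lambda>y. (F y - F t) / (y - t)) \<longlongrightarrow> D) (at t within S)"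
      using that(1) by (simp add: has_field_derivative_iff)
    moreover have "filterlim (\<lambda>n. t + \<epsilon> n) (at t within S) sequentially"
      unfolding filterlim_at
    proof
      show "\<forall>\<^sub>F n in sequentially. t + \<epsilon> n \<in> S \<and> t + \<epsilon> n \<noteq> t"
        using eventually_ge_at_top[of N] by eventually_elim (use that(2) \<epsilon>_ne in auto)
      show "(\<lambda>n. t + \<epsilon> n) \<longlonglongrightarrow> t" using tendsto_add[OF tendsto_const \<epsilon>_lim, of t] by simp
    qed
    ultimately have "((\<lambda>n. (F (t + \<epsilon> n) - F t) / ((t + \<epsilon> n) - t)) \<longlonglongrightarrow> D)"
      by (rule filterlim_compose)
    then show ?thesis by simp
  qed
  have K_lim: "(\<lambda>n. K n t) \<longlonglongrightarrow> h t" if "t \<in> {a..b}" for t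
    unfolding K_def by (rule quot[OF H_deriv, of t 0]) (use that \<epsilon> in \<open>auto intro: add_mono add_nonneg_nonneg less_imp_le add_increasing2\<close>)
  obtain N where N: "negligible N"
    "\<And>t. t \<notin> N \<Longrightarrow> t \<in> {a..b} \<Longrightarrow> (g has_real_derivative g' t) (at t within {a..b})"
    using deriv unfolding eventually_ae_filter_negligible by (auto simp: subset_iff)
  define S where "S = {a..b} - (N \<union> {b})"
  have neg: "negligible (N \<union> {b})" using N(1) by (auto intro: negligible_Un)
  have S_int: "(f has_integral i) S \<longleftrightarrow> (f has_integral i) {a..b}" for f :: "real \<Rightarrow> real" and i
    by (rule has_integral_spike_set_eq)
      (auto intro: negligible_subset[OF neg] simp: S_def)
  have Q_lim: "(\<lambda>n. Q n t) \<longlonglongrightarrow> g' t" if "t \<in> S" for t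
  proof -
    have t: "t \<in> {a..b}" "t < b" "t \<notin> N" using that by (auto simp: S_def)
    have g1: "(g has_real_derivative g' t) (at t within {a..b})" using N(2) t by blast
    have "(h has_real_derivative g' t) (at t within {a..b})"
      by (rule has_field_derivative_transform_within[OF g1 zero_less_one t(1)]) (auto simp: h_def max_def min_def)
    moreover have "\<forall>\<^sub>F n in sequentially. \<epsilon> n < b - t"
      using \<epsilon>_lim t by (auto intro: order_tendstoD)
    then obtain N' where "\<And>n. n \<ge> N' \<Longrightarrow> \<epsilon> n < b - t" by (auto simp: eventually_sequentially)
    then have "\<And>n. n \<ge> N' \<Longrightarrow> t + \<epsilon> n \<in> {a..b}" using t \<epsilon> by (force intro: add_increasing2 less_imp_le)
    ultimately show ?thesis unfolding Q_def by (rule quot)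
  qed
  have Q_bd: "norm (Q n t) \<le> C" for n t
    using h_lip[of "t + \<epsilon> n" t] \<epsilon>[of n] by (simp add: Q_def divide_le_eq)
  have QS: "(Q n has_integral K n b - K n a) S" for n using Q_int S_int by blast
  have const: "(\<lambda>t. C) integrable_on S"
    using S_int integrable_const_ivl[of C a b] unfolding integrable_on_def by metis
  have "g' integrable_on S" "(\<lambda>n. integral S (Q n)) \<longlonglongrightarrow> integral S g'"
    using dominated_convergence[of Q S "\<lambda>t. C" g'] QS const Q_bd Q_lim by auto
  moreover have "(\<lambda>n. integral S (Q n)) \<longlonglongrightarrow> h b - h a"
    using tendsto_diff[OF K_lim[of b] K_lim[of a]] ab integral_unique[OF QS] by simp
  ultimately have "(g' has_integral h b - h a) S"
    by (metis LIMSEQ_unique has_integral_iff)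
  then show ?thesis using S_int ab by (simp add: h_def)
qed

text \<open>
  If a product of functions of two independent variables converges to a nonzero limit, then each
  factor converges, because the ratio of two values of one factor is the ratio of two values of
  the product with a common second argument. This is what turns a bound for the area of small
  rectangles into differentiability in each of the two directions.
\<close>

lemma tendsto_factor_of_product:
  fixes \<Phi> :: "'a \<Rightarrow> real" and \<Psi> :: "'b \<Rightarrow> real"
  assumes lim: "((\<lambda>(s, t). \<Phi> s * \<Psi> t) \<longlongrightarrow> c) (F \<times>\<^sub>F G)" and c: "c \<noteq> 0"
    and F: "F \<noteq> bot" and G: "G \<noteq> bot"
  obtains l where "(\<Phi> \<longlongrightarrow> l) F"
proof -
  have "cauchy_filter (filtermap \<Phi> F)"
    unfolding cauchy_filter_metric_filtermap
  proof (intro allI impI)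
    fix e :: real assume e: "e > 0"
    have "\<exists>t P. eventually P F \<and> \<Psi> t \<noteq> 0 \<and> (\<forall>s. P s \<longrightarrow> \<bar>\<Phi> s * \<Psi> t - c\<bar> < d)" if "d > 0" "d < \<bar>c\<bar>" for d
    proof -
      have "\<forall>\<^sub>F (s, t) in F \<times>\<^sub>F G. \<bar>\<Phi> s * \<Psi> t - c\<bar> < d"
        using tendstoD[OF lim that(1)] by (simp add: dist_real_def case_prod_unfold)
      then obtain P R where P: "eventually P F" "eventually R G"
        "\<And>s t. P s \<Longrightarrow> R t \<Longrightarrow> \<bar>\<Phi> s * \<Psi> t - c\<bar> < d"
        by (auto simp: eventually_prod_filter)
      obtain t where t: "R t" using eventually_happens'[OF G P(2)] by blast
      obtain s where s: "P s" using eventually_happens'[OF F P(1)] by blast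
      have "\<Psi> t \<noteq> 0" using P(3)[OF s t] that by auto
      then show ?thesis using P t by blast
    qed
    note * = this
    obtain t0 P0 where 0: "eventually P0 F" "\<Psi> t0 \<noteq> 0" "\<And>s. P0 s \<Longrightarrow> \<bar>\<Phi> s * \<Psi> t0 - c\<bar> < \<bar>c\<bar> / 2"
      using *[of "\<bar>c\<bar> / 2"] c by auto
    \<comment> \<open>The first choice bounds the factor; the second one makes its relative oscillation small.\<close>
    define B where "B = (3 / 2) * \<bar>c\<bar> / \<bar>\<Psi> t0\<bar>"
    have B: "B > 0" "\<bar>\<Phi> s\<bar> \<le> B" if "P0 s" for s
    proof -
      show "B > 0" using c 0 by (simp add: B_def)
      have "\<bar>\<Phi> s\<bar> * \<bar>\<Psi> t0\<bar> \<le> (3 / 2) * \<bar>c\<bar>"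
        unfolding abs_mult[symmetric] using 0(3)[OF that] by linarith
      then show "\<bar>\<Phi> s\<bar> \<le> B" using 0(2) by (simp add: B_def pos_le_divide_eq)
    qed
    have Bpos: "B > 0" using c 0(2) by (simp add: B_def)
    define d where "d = min (\<bar>c\<bar> / 2) (e * \<bar>c\<bar> / (8 * B))"
    have d: "d > 0" "d < \<bar>c\<bar>" "d \<le> \<bar>c\<bar> / 2" "d \<le> e * \<bar>c\<bar> / (8 * B)"
      using c e Bpos by (auto simp: d_def)
    obtain t P where 1: "eventually P F" "\<Psi> t \<noteq> 0" "\<And>s. P s \<Longrightarrow> \<bar>\<Phi> s * \<Psi> t - c\<bar> < d"
      using *[OF d(1,2)] by blast
    have "dist (\<Phi> x) (\<Phi> y) < e" if "P x" "P0 x" "P y" for x y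
    proof -
      have "\<bar>c\<bar> / 2 \<le> \<bar>\<Phi> x * \<Psi> t\<bar>" using 1(3)[OF that(1)] d by linarith
      also have "\<dots> \<le> B * \<bar>\<Psi> t\<bar>" unfolding abs_mult using B(2)[OF that(2)] by (simp add: mult_right_mono)
      finally have t: "\<bar>c\<bar> / (2 * B) \<le> \<bar>\<Psi> t\<bar>" using Bpos by (simp add: field_simps)
      have "\<bar>\<Phi> x - \<Phi> y\<bar> * \<bar>\<Psi> t\<bar> = \<bar>(\<Phi> x * \<Psi> t - c) - (\<Phi> y * \<Psi> t - c)\<bar>"
        unfolding abs_mult[symmetric] by (simp add: algebra_simps)
      also have "\<dots> < 2 * d" using 1(3)[OF that(1)] 1(3)[OF that(3)] by linarith
      also have "\<dots> \<le> e * (\<bar>c\<bar> / (4 * B))" using d by (simp add: field_simps)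
      also have "\<dots> \<le> e * (\<bar>c\<bar> / (2 * B))" using e Bpos by (intro mult_left_mono divide_left_mono) auto
      also have "\<dots> \<le> e * \<bar>\<Psi> t\<bar>" using t e by (intro mult_left_mono) auto
      finally show ?thesis using 1(2) by (simp add: dist_real_def)
    qed
    then show "\<exists>P. eventually P F \<and> (\<forall>x y. P x \<and> P y \<longrightarrow> dist (\<Phi> x) (\<Phi> y) < e)"
      using 0(1) 1(1) by (intro exI[of _ "\<lambda>s. P s \<and> P0 s"]) (auto simp: eventually_conj)
  qed
  moreover have "filtermap \<Phi> F \<noteq> bot" using F by (simp add: filtermap_bot_iff)
  ultimately obtain l where "filtermap \<Phi> F \<le> nhds l"
    using complete_UNIV unfolding complete_uniform by (metis UNIV_I principal_UNIV top_greatest)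
  then show ?thesis using that by (simp add: filterlim_def)
qed

lemma tendsto_factors_of_product:
  fixes \<Phi> :: "'a \<Rightarrow> real" and \<Psi> :: "'b \<Rightarrow> real"
  assumes lim: "((\<lambda>(s, t). \<Phi> s * \<Psi> t) \<longlongrightarrow> c) (F \<times>\<^sub>F G)" and c: "c \<noteq> 0"
    and F: "F \<noteq> bot" and G: "G \<noteq> bot"
  obtains l m where "(\<Phi> \<longlongrightarrow> l) F" "(\<Psi> \<longlongrightarrow> m) G" "l * m = c"
proof -
  obtain l where l: "(\<Phi> \<longlongrightarrow> l) F" using tendsto_factor_of_product[OF assms] .
  have "((\<lambda>(t, s). \<Psi> t * \<Phi> s) \<longlongrightarrow> c) (G \<times>\<^sub>F F)"
    using filterlim_compose[OF lim filterlim_Pair[OF filterlim_snd filterlim_fst]]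
    by (simp add: case_prod_unfold mult.commute)
  then obtain m where m: "(\<Psi> \<longlongrightarrow> m) G" using tendsto_factor_of_product c F G by blast
  have "((\<lambda>(s, t). \<Phi> s * \<Psi> t) \<longlongrightarrow> l * m) (F \<times>\<^sub>F G)"
    unfolding case_prod_unfold
    by (intro tendsto_mult filterlim_compose[OF l filterlim_fst] filterlim_compose[OF m filterlim_snd])
  then have "l * m = c" using lim F G
    by (intro tendsto_unique[of "F \<times>\<^sub>F G"]) (auto simp: prod_filter_eq_bot)
  then show ?thesis using that l m by blast
qed

section \<open>Blow-up of Riccati equations\<close>

text \<open>
  Beyond the given bound on \<open>u 0\<close> the quadratic term dominates, the right-hand side is at least
  \<open>q2 * u\<^sup>2 / 2\<close>, and the solution increases. Then \<open>1 / u\<close> decreases at least linearly, which would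
  make it vanish at time \<open>2 / (q2 * u 0)\<close>.
\<close>

lemma riccati_solution_blows_up_pos:
  fixes u :: "real \<Rightarrow> real"
  assumes deriv: "\<And>t. (u has_real_derivative q0 + q1 * u t + q2 * (u t)\<^sup>2) (at t)"
    and q2: "q2 > 0" and large: "1 + 2 * (\<bar>q0\<bar> + \<bar>q1\<bar>) / q2 < u 0"
  shows False
proof -
  have u0: "u 0 > 1" using large q2 by (smt (verit) divide_nonneg_pos)
  have rate: "q0 + q1 * x + q2 * x\<^sup>2 \<ge> q2 / 2 * x\<^sup>2" if x: "x \<ge> u 0" for x
  proof -
    have x1: "x > 1" using x u0 by simp
    have "2 * (\<bar>q0\<bar> + \<bar>q1\<bar>) / q2 < x" using x large by simp
    then have *: "2 * (\<bar>q0\<bar> + \<bar>q1\<bar>) \<le> q2 * x" using q2 by (simp add: field_simps)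
    have "- (q0 + q1 * x) \<le> \<bar>q0\<bar> * x + \<bar>q1\<bar> * x"
    proof -
      have "\<bar>q0\<bar> * 1 \<le> \<bar>q0\<bar> * x" using x1 by (intro mult_left_mono) auto
      moreover have "- (q1 * x) \<le> \<bar>q1\<bar> * x" 
        using mult_right_mono[of "- q1" "\<bar>q1\<bar>" x] x1 by simp
      ultimately show ?thesis by linarith
    qed
    also have "\<dots> \<le> q2 / 2 * x\<^sup>2"
      using mult_right_mono[OF *, of x] x1 by (simp add: power2_eq_square algebra_simps)
    finally show ?thesis by linarith
  qed
  have stay: "u t \<ge> u 0" if "t \<ge> 0" for t
  proof (rule ccontr)
    assume "\<not> u t \<ge> u 0"
    then have less: "u t < u 0" by simp
    \<comment> \<open>The last time at which the initial value is still reached.\<close>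
    define S where "S = {s \<in> {0..t}. u 0 \<le> u s}"
    have cont: "continuous_on {0..t} u"
      using DERIV_isCont[OF deriv] by (intro continuous_at_imp_continuous_on) auto
    have "closed ({0..t} \<inter> u -` {u 0..})"
      by (intro continuous_closed_preimage cont) auto
    moreover have "{0..t} \<inter> u -` {u 0..} = S" by (auto simp: S_def)
    moreover have "bounded S" by (rule bounded_subset[of "{0..t}"]) (auto simp: S_def)
    ultimately have "compact S" by (simp add: compact_eq_bounded_closed)
    moreover have "0 \<in> S" using that by (simp add: S_def)
    ultimately obtain s where s: "s \<in> S" "\<And>r. r \<in> S \<Longrightarrow> r \<le> s"
      by (metis compact_attains_sup empty_iff)
    have s': "s \<le> t" "0 \<le> s" "u 0 \<le> u s" using s(1) by (auto simp: S_def)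
    moreover have "s \<noteq> t" using s'(3) less by auto
    ultimately have st: "s < t" "0 \<le> s" "u 0 \<le> u s" by auto
    have "0 < (q2 / 2) * (u s)\<^sup>2" using q2 st u0 by simp
    also note rate[OF st(3)]
    finally obtain e where e: "e > 0" "\<And>h. 0 < h \<Longrightarrow> h < e \<Longrightarrow> u s < u (s + h)"
      using DERIV_pos_inc_right[OF deriv[of s]] by blast
    define h where "h = min (e / 2) (t - s)"
    have h: "0 < h" "h < e" "h \<le> t - s" using e st by (auto simp: h_def)
    have "s + h \<in> S" using e(2)[OF h(1,2)] h st by (auto simp: S_def)
    then show False using s(2) h(1) by fastforce
  qed
  have "1 / u t \<le> 1 / u 0 - q2 / 2 * t" if "t \<ge> 0" for t
  proof -
    have "1 / u t + q2 / 2 * t \<le> 1 / u 0 + q2 / 2 * 0"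
    proof (rule DERIV_nonpos_imp_nonincreasing[OF that])
      fix x assume x: "0 \<le> x" "x \<le> t"
      have ux: "u x \<ge> u 0" "u x > 0" using stay[OF x(1)] u0 by auto
      have "((\<lambda>x. 1 / u x + q2 / 2 * x) has_real_derivative
          - (q0 + q1 * u x + q2 * (u x)\<^sup>2) / (u x)\<^sup>2 + q2 / 2) (at x)"
        using ux by (auto intro!: derivative_eq_intros deriv simp: power2_eq_square)
      moreover have "- (q0 + q1 * u x + q2 * (u x)\<^sup>2) / (u x)\<^sup>2 + q2 / 2 \<le> 0"
        using rate[OF ux(1)] ux by (simp add: field_simps)
      ultimately show "\<exists>y. ((\<lambda>x. 1 / u x + q2 / 2 * x) has_real_derivative y) (at x) \<and> y \<le> 0"
        by blast
    qed
    then show ?thesis by simp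
  qed
  note bound = this
  have "1 / u (2 / (q2 * u 0)) \<le> 1 / u 0 - q2 / 2 * (2 / (q2 * u 0))"
    by (rule bound) (use q2 u0 in auto)
  also have "\<dots> = 0" using q2 u0 by (simp add: field_simps)
  finally show False using stay[of "2 / (q2 * u 0)"] q2 u0
    by (smt (verit) divide_pos_pos mult_pos_pos)
qed

text \<open>
  Reflections of the solution in space and in time give all sign combinations.
\<close>

lemma riccati_solution_blows_up:
  fixes u :: "real \<Rightarrow> real"
  assumes deriv: "\<And>t. (u has_real_derivative q0 + q1 * u t + q2 * (u t)\<^sup>2) (at t)"
    and q2: "q2 \<noteq> 0" and large: "1 + 2 * (\<bar>q0\<bar> + \<bar>q1\<bar>) / \<bar>q2\<bar> < \<bar>u 0\<bar>"
  shows False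
proof -
  define \<sigma> where "\<sigma> = (if u 0 \<ge> 0 then 1 else -1 :: real)"
  define \<tau> where "\<tau> = (if \<sigma> * q2 > 0 then 1 else -1 :: real)"
  have \<sigma>: "\<sigma> * \<sigma> = 1" "\<sigma> * u 0 = \<bar>u 0\<bar>" "\<bar>\<sigma>\<bar> = 1" by (auto simp: \<sigma>_def)
  have \<tau>: "\<bar>\<tau>\<bar> = 1" "\<sigma> * \<tau> * q2 = \<bar>q2\<bar>" using q2 by (auto simp: \<tau>_def \<sigma>_def)
  define v where "v t = \<sigma> * u (\<tau> * t)" for t
  have uv: "u (\<tau> * t) = \<sigma> * v t" for t using \<sigma>(1) by (simp add: v_def mult.assoc[symmetric])
  show False
  proof (rule riccati_solution_blows_up_pos)
    fix t
    have "((\<lambda>t. \<sigma> * u (\<tau> * t)) has_real_derivative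
        \<sigma> * ((q0 + q1 * u (\<tau> * t) + q2 * (u (\<tau> * t))\<^sup>2) * \<tau>)) (at t)"
      by (rule DERIV_cmult, rule DERIV_chain2[OF deriv]) (auto intro!: derivative_eq_intros)
    moreover have "\<sigma> * ((q0 + q1 * u (\<tau> * t) + q2 * (u (\<tau> * t))\<^sup>2) * \<tau>) =
        \<sigma> * \<tau> * q0 + \<tau> * q1 * v t + \<sigma> * \<tau> * q2 * (v t)\<^sup>2"
    proof -
      have "(u (\<tau> * t))\<^sup>2 = (v t)\<^sup>2" unfolding uv using \<sigma>(1) by (simp add: power_mult_distrib power2_eq_square)
      moreover have "\<sigma> * u (\<tau> * t) = v t" by (simp add: v_def)
      ultimately show ?thesis by (simp add: algebra_simps)
    qed
    ultimately show "(v has_real_derivative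
        \<sigma> * \<tau> * q0 + \<tau> * q1 * v t + \<sigma> * \<tau> * q2 * (v t)\<^sup>2) (at t)"
      by (simp add: v_def[abs_def])
  next
    show "\<sigma> * \<tau> * q2 > 0" using \<tau> q2 by simp
    show "1 + 2 * (\<bar>\<sigma> * \<tau> * q0\<bar> + \<bar>\<tau> * q1\<bar>) / (\<sigma> * \<tau> * q2) < v 0"
      using large \<tau> \<sigma> by (simp add: abs_mult v_def)
  qed
qed

section \<open>Functional equations on a half-plane\<close>

lemma affine_zero_on_half_plane:
  fixes \<alpha> \<beta> a b c :: real
  assumes ne: "\<alpha> \<noteq> 0 \<or> \<beta> \<noteq> 0"
    and zero: "\<And>s t. \<alpha> * t + \<beta> * s > 0 \<Longrightarrow> a * t + b * s + c = 0"
  shows "a = 0 \<and> b = 0 \<and> c = 0"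
proof -
  have n: "\<alpha> * \<alpha> + \<beta> * \<beta> > 0" using ne
    by (metis add_cancel_right_right not_sum_squares_lt_zero sum_squares_gt_zero_iff)
  have 1: "a * \<alpha> + b * \<beta> + c = 0" using zero[of \<alpha> \<beta>] n by simp
  have 2: "a * (2 * \<alpha>) + b * (2 * \<beta>) + c = 0"
    using zero[of "2 * \<alpha>" "2 * \<beta>"] n by (simp add: algebra_simps)
  have 3: "a * (\<alpha> + \<beta>) + b * (\<beta> - \<alpha>) + c = 0"
    using zero[of "\<alpha> + \<beta>" "\<beta> - \<alpha>"] n by (simp add: algebra_simps)
  have c: "c = 0" using 1 2 by (simp add: algebra_simps)
  have 4: "a * \<alpha> + b * \<beta> = 0" "a * \<beta> - b * \<alpha> = 0" using 1 3 c by (auto simp: algebra_simps)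
  have "(\<alpha> * \<alpha> + \<beta> * \<beta>) * a = 0" "(\<alpha> * \<alpha> + \<beta> * \<beta>) * b = 0" using 4 by algebra+
  then show ?thesis using c n by auto
qed

text \<open>
  A line parallel to the first axis and far out meets the half-plane in a set that contains any
  prescribed bounded range of the first coordinate. Two such lines give two equations for the
  same unknown values.
\<close>

lemma common_transversals:
  fixes \<alpha> \<beta> :: real
  assumes "\<alpha> \<noteq> 0"
  obtains t1 t2 where "t1 < t2"
    "\<And>x. \<bar>x\<bar> \<le> R \<Longrightarrow> \<alpha> * t1 + \<beta> * x > 0" "\<And>x. \<bar>x\<bar> \<le> R \<Longrightarrow> \<alpha> * t2 + \<beta> * x > 0"
proof -
  define M where "M = (\<bar>\<beta>\<bar> * \<bar>R\<bar> + 1) / \<alpha>\<^sup>2"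
  have a2: "\<alpha>\<^sup>2 > 0" using assms by simp
  have big: "\<alpha> * (\<alpha> * k) + \<beta> * x > 0" if "k \<ge> M" "\<bar>x\<bar> \<le> R" for k x
  proof -
    have "\<alpha> * (\<alpha> * k) \<ge> \<alpha>\<^sup>2 * M" using that a2
      by (simp add: power2_eq_square mult.assoc[symmetric] mult_left_mono)
    also have "\<alpha>\<^sup>2 * M = \<bar>\<beta>\<bar> * \<bar>R\<bar> + 1" using assms by (simp add: M_def)
    finally have "\<alpha> * (\<alpha> * k) \<ge> \<bar>\<beta>\<bar> * \<bar>R\<bar> + 1" .
    moreover have "\<bar>\<beta> * x\<bar> \<le> \<bar>\<beta>\<bar> * \<bar>R\<bar>" unfolding abs_mult using that by (intro mult_left_mono) auto
    ultimately show ?thesis by linarith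
  qed
  show ?thesis
  proof (cases "\<alpha> > 0")
    case True
    then show ?thesis using big[of M] big[of "M + 1"]
      by (intro that[of "\<alpha> * M" "\<alpha> * (M + 1)"]) auto
  next
    case False
    then have "\<alpha> < 0" using assms by simp
    then show ?thesis using big[of M] big[of "M + 1"]
      by (intro that[of "\<alpha> * (M + 1)" "\<alpha> * M"]) auto
  qed
qed

text \<open>
  If \<open>\<alpha>\<close> and \<open>\<beta>\<close> are nonzero, two values of \<open>t\<close> give two linear equations for \<open>f s\<close> and \<open>f' s\<close>, and
  eliminating \<open>f' s\<close> expresses \<open>f s\<close> as a quadratic polynomial in \<open>s\<close>. Its coefficients depend on
  the range of \<open>s\<close> for which both values of \<open>t\<close> are admissible, so they are recovered by
  interpolation at -1, 0 and 1. In the two degenerate (flat) cases \<open>t\<close> can be fixed, and what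
  remains is an ordinary differential equation for \<open>f\<close> with quadratic solutions.
\<close>

lemma killing_component_quadratic:
  fixes f f' g g' :: "real \<Rightarrow> real"
  assumes ne: "\<alpha> \<noteq> 0 \<or> \<beta> \<noteq> 0"
    and deriv: "\<And>s t. \<alpha> * t + \<beta> * s > 0 \<Longrightarrow> (f has_real_derivative f' s) (at s)"
    and eq: "\<And>s t. \<alpha> * t + \<beta> * s > 0 \<Longrightarrow>
      (f' s + g' t) * (\<alpha> * t + \<beta> * s) = 2 * (\<beta> * f s + \<alpha> * g t)"
  obtains q0 q1 q2 where "\<And>s t. \<alpha> * t + \<beta> * s > 0 \<Longrightarrow> f s = q0 + q1 * s + q2 * s\<^sup>2"
proof -
  consider "\<beta> = 0" "\<alpha> \<noteq> 0" | "\<alpha> = 0" "\<beta> \<noteq> 0" | "\<alpha> \<noteq> 0" "\<beta> \<noteq> 0" using ne by blast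
  then show thesis
  proof cases
    case 1
    then have pos: "\<alpha> * \<alpha> + \<beta> * s > 0" for s using 1 by (auto simp: zero_less_mult_iff linorder_neq_iff)
    define k where "k = 2 * g \<alpha> / \<alpha> - g' \<alpha>"
    have k: "f' s = k" for s
    proof -
      have "(f' s + g' \<alpha>) * \<alpha> = 2 * g \<alpha>"
        using eq[OF pos[of s]] 1 by simp
      then show ?thesis using 1 by (simp add: k_def field_simps)
    qed
    have "((\<lambda>s. f s - k * s) has_real_derivative 0) (at s)" for s
      using deriv[OF pos[of s]] k by (auto intro!: derivative_eq_intros)
    then have *: "f s - k * s = f 0 - k * 0" for s by (intro DERIV_isconst_all) auto
    have "f s = f 0 + k * s + 0 * s\<^sup>2" for s using *[of s] by linarith
    then show ?thesis by (rule that)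
  next
    case 2
    define P where "P = {s. \<beta> * s > 0}"
    have P: "convex P" unfolding P_def using convex_halfspace_gt[of 0 \<beta>] by (simp add: inner_real_def)
    define k where "k = g' 0"
    have ode: "f' s * s = 2 * f s - k * s" if "s \<in> P" for s
    proof -
      have "\<beta> * (f' s * s + k * s) = \<beta> * (2 * f s)" using eq[of 0 s] that 2 by (simp add: P_def k_def algebra_simps)
      then show ?thesis using 2 by simp
    qed
    have "\<exists>c. \<forall>s\<in>P. (f s - k * s) / s\<^sup>2 = c"
    proof (rule has_field_derivative_zero_constant[OF P])
      fix s assume s: "s \<in> P"
      then have s0: "s \<noteq> 0" by (auto simp: P_def)
      have "((\<lambda>s. (f s - k * s) / s\<^sup>2) has_real_derivative
          ((f' s - k) * s\<^sup>2 - (f s - k * s) * (2 * s)) / (s\<^sup>2 * s\<^sup>2)) (at s within P)"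
      proof (rule DERIV_divide)
        have "(f has_real_derivative f' s) (at s within P)"
          using deriv[of 0 s] s 2 by (simp add: P_def has_field_derivative_at_within)
        from DERIV_diff[OF this DERIV_cmult_Id[of k]]
        show "((\<lambda>s. f s - k * s) has_real_derivative f' s - k) (at s within P)" .
        show "((\<lambda>s. s\<^sup>2) has_real_derivative 2 * s) (at s within P)"
          by (auto intro!: derivative_eq_intros)
        show "s\<^sup>2 \<noteq> 0" using s0 by simp
      qed
      moreover have "(f' s - k) * s\<^sup>2 - (f s - k * s) * (2 * s) = 0"
        using ode[OF s] by (simp add: power2_eq_square) algebra
      ultimately show "((\<lambda>s. (f s - k * s) / s\<^sup>2) has_real_derivative 0) (at s within P)" by simp
    qed
    then obtain c where c: "\<And>s. s \<in> P \<Longrightarrow> (f s - k * s) / s\<^sup>2 = c" by blast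
    have "f s = 0 + k * s + c * s\<^sup>2" if "\<beta> * s > 0" for s
    proof -
      have "s \<noteq> 0" "s \<in> P" using that by (auto simp: P_def)
      then show ?thesis using c[of s] by (auto simp: field_simps)
    qed
    then show ?thesis using that[of 0 k c] 2 by simp
  next
    case 3
    have lagrange: "f s = f 0 + (f 1 - f (-1)) / 2 * s + ((f 1 + f (-1)) / 2 - f 0) * s\<^sup>2" for s
    proof -
      obtain t1 t2 where t: "t1 < t2"
        "\<And>x. \<bar>x\<bar> \<le> \<bar>s\<bar> + 1 \<Longrightarrow> \<alpha> * t1 + \<beta> * x > 0" "\<And>x. \<bar>x\<bar> \<le> \<bar>s\<bar> + 1 \<Longrightarrow> \<alpha> * t2 + \<beta> * x > 0"
        using common_transversals[OF 3(1), of "\<bar>s\<bar> + 1" \<beta>] by metis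
      define K where "K = 2 * \<alpha> * \<beta> * (t2 - t1)"
      define D where "D = g' t1 - g' t2"
      have K: "K \<noteq> 0" using 3 t by (simp add: K_def)
      have "K * f x = (D * \<alpha>\<^sup>2 * t1 * t2 + 2 * \<alpha>\<^sup>2 * (g t2 * t1 - g t1 * t2))
          + (D * \<alpha> * \<beta> * (t1 + t2) + 2 * \<alpha> * \<beta> * (g t2 - g t1)) * x + D * \<beta>\<^sup>2 * x\<^sup>2"
        if "\<bar>x\<bar> \<le> \<bar>s\<bar> + 1" for x
        using eq[OF t(2)[OF that]] eq[OF t(3)[OF that]] unfolding K_def D_def by algebra
      then obtain c0 c1 c2 where
        quad: "\<And>x. \<bar>x\<bar> \<le> \<bar>s\<bar> + 1 \<Longrightarrow> K * f x = c0 + c1 * x + c2 * x\<^sup>2"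
        by blast
      have "c0 = K * f 0" "c1 = K * ((f 1 - f (-1)) / 2)" "c2 = K * ((f 1 + f (-1)) / 2 - f 0)"
        using quad[of 0] quad[of 1] quad[of "-1"] by (simp_all add: field_simps)
      then have "K * f s = K * (f 0 + (f 1 - f (-1)) / 2 * s + ((f 1 + f (-1)) / 2 - f 0) * s\<^sup>2)"
        using quad[of s] by (simp add: distrib_left mult.assoc)
      then show ?thesis using K by simp
    qed
    show ?thesis by (rule that) (rule lagrange)
  qed
qed

text \<open>
  The equation says that the product map \<open>(\<phi>, \<psi>)\<close> preserves the
  metric \<open>ds dt / (\<alpha> * t + \<beta> * s)\<^sup>2\<close>. If \<open>\<alpha>\<close> and \<open>\<beta>\<close> are nonzero, taking square roots and
  subtracting the equations for two values of \<open>t\<close> shows that \<open>1 / sqrt (\<phi>' s)\<close> is an affine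
  function of \<open>s\<close>; locally \<open>\<phi>\<close> is a projective map of the line. But \<open>\<phi>\<close> is defined on the whole
  line, and an affine function that is positive on the whole line is constant. In the flat case
  \<open>\<alpha> = 0\<close>, where \<open>\<phi>\<close> acts on a half-line, \<open>1 / \<phi> s\<close> differs from a multiple of \<open>1 / s\<close> by a constant,
  which vanishes because \<open>\<phi>\<close> maps the half-line onto itself.
\<close>

lemma conformal_factor_component_affine:
  fixes \<phi> \<phi>' \<psi> \<psi>' :: "real \<Rightarrow> real"
  assumes ne: "\<alpha> \<noteq> 0 \<or> \<beta> \<noteq> 0"
    and pos: "\<And>s t. \<alpha> * t + \<beta> * s > 0 \<Longrightarrow> \<alpha> * \<psi> t + \<beta> * \<phi> s > 0"
    and deriv: "\<And>s t. \<alpha> * t + \<beta> * s > 0 \<Longrightarrow> (\<phi> has_real_derivative \<phi>' s) (at s)"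
    and dpos: "\<And>s t. \<alpha> * t + \<beta> * s > 0 \<Longrightarrow> \<phi>' s > 0 \<and> \<psi>' t > 0"
    and inj: "\<And>s t t'. \<alpha> * t + \<beta> * s > 0 \<Longrightarrow> \<alpha> * t' + \<beta> * s > 0 \<Longrightarrow> t < t' \<Longrightarrow> \<psi> t < \<psi> t'"
    and surj: "\<And>s t. \<alpha> * t + \<beta> * s > 0 \<Longrightarrow> \<exists>s' t'. \<alpha> * t' + \<beta> * s' > 0 \<and> \<phi> s' = s"
    and eq: "\<And>s t. \<alpha> * t + \<beta> * s > 0 \<Longrightarrow>
      \<phi>' s * \<psi>' t * (\<alpha> * t + \<beta> * s)\<^sup>2 = (\<alpha> * \<psi> t + \<beta> * \<phi> s)\<^sup>2"
  obtains \<kappa> \<mu> where "\<And>s t. \<alpha> * t + \<beta> * s > 0 \<Longrightarrow> \<phi> s = \<kappa> * s + \<mu>"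
proof -
  note conclude = that
  have affine: thesis if all: "\<And>s. \<exists>t. \<alpha> * t + \<beta> * s > 0" and k: "\<And>s. \<phi>' s = k" for k
  proof -
    have "((\<lambda>s. \<phi> s - k * s) has_real_derivative k - k) (at s)" for s
    proof -
      obtain t where "\<alpha> * t + \<beta> * s > 0" using all by blast
      from DERIV_diff[OF deriv[OF this] DERIV_cmult_Id[of k]] show ?thesis by (simp add: k)
    qed
    then have *: "\<phi> s - k * s = \<phi> 0 - k * 0" for s by (intro DERIV_isconst_all) auto
    have "\<phi> s = k * s + \<phi> 0" for s using *[of s] by linarith
    then show ?thesis by (rule conclude)
  qed
  consider "\<beta> = 0" "\<alpha> \<noteq> 0" | "\<alpha> = 0" "\<beta> \<noteq> 0" | "\<alpha> \<noteq> 0" "\<beta> \<noteq> 0" using ne by blast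
  then show thesis
  proof cases
    case 1
    then have p: "\<alpha> * \<alpha> + \<beta> * s > 0" for s by (auto simp: zero_less_mult_iff linorder_neq_iff)
    show ?thesis
    proof (rule affine)
      show "\<exists>t. \<alpha> * t + \<beta> * s > 0" for s using p by blast
      show "\<phi>' s = (\<alpha> * \<psi> \<alpha>)\<^sup>2 / (\<psi>' \<alpha> * (\<alpha> * \<alpha>)\<^sup>2)" for s
        using eq[OF p[of s]] dpos[OF p[of s]] 1 by (simp add: field_simps)
    qed
  next
    case 2
    define P where "P = {s. \<beta> * s > 0}"
    define E where "E = \<psi>' 0"
    have P: "convex P" unfolding P_def using convex_halfspace_gt[of 0 \<beta>] by (simp add: inner_real_def)
    have dom: "\<alpha> * 0 + \<beta> * s > 0" if "s \<in> P" for s using that 2 by (simp add: P_def)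
    have "\<beta> \<in> P" using 2 by (auto simp: P_def zero_less_mult_iff linorder_neq_iff)
    then have E: "E > 0" using dpos[OF dom] by (auto simp: E_def)
    have \<phi>_pos: "\<beta> * \<phi> s > 0" if "s \<in> P" for s using pos[OF dom[OF that]] 2 by simp
    have ode: "\<phi>' s * E * s\<^sup>2 = (\<phi> s)\<^sup>2" if "s \<in> P" for s
    proof -
      have "\<beta>\<^sup>2 * (\<phi>' s * E * s\<^sup>2) = \<beta>\<^sup>2 * (\<phi> s)\<^sup>2"
        using eq[OF dom[OF that]] 2 by (simp add: E_def power_mult_distrib algebra_simps)
      then show ?thesis using 2 by simp
    qed
    have "\<exists>c. \<forall>s\<in>P. 1 / \<phi> s - 1 / (E * s) = c"
    proof (rule has_field_derivative_zero_constant[OF P])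
      fix s assume s: "s \<in> P"
      then have nz: "s \<noteq> 0" "\<phi> s \<noteq> 0" using \<phi>_pos[OF s] by (auto simp: P_def)
      have d: "(\<phi> has_real_derivative \<phi>' s) (at s within P)"
        using deriv[OF dom[OF s]] by (rule has_field_derivative_at_within)
      have "((\<lambda>s. 1 / \<phi> s - 1 / (E * s)) has_real_derivative
          (0 * \<phi> s - 1 * \<phi>' s) / (\<phi> s * \<phi> s) - (0 * (E * s) - 1 * E) / ((E * s) * (E * s))) (at s within P)"
        using nz E by (intro DERIV_diff DERIV_divide d DERIV_const DERIV_cmult_Id) auto
      moreover have "(0 * \<phi> s - 1 * \<phi>' s) / (\<phi> s * \<phi> s) - (0 * (E * s) - 1 * E) / ((E * s) * (E * s)) = 0"
        using ode[OF s] nz E by (simp add: field_simps power2_eq_square)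
      ultimately show "((\<lambda>s. 1 / \<phi> s - 1 / (E * s)) has_real_derivative 0) (at s within P)" by simp
    qed
    then obtain c where c: "\<And>s. s \<in> P \<Longrightarrow> 1 / \<phi> s = 1 / (E * s) + c" by (force simp: algebra_simps)
    \<comment> \<open>A nonzero \<open>c\<close> would make \<open>1 / \<phi>\<close> vanish somewhere or keep \<open>\<phi>\<close> away from the value \<open>1 / c\<close>.\<close>
    have "c = 0"
    proof (rule ccontr)
      assume c0: "c \<noteq> 0"
      consider "\<beta> * c < 0" | "\<beta> * c > 0" using c0 2 by (metis linorder_neqE mult_eq_0_iff)
      then show False
      proof cases
        case 1
        define s where "s = - 1 / (E * c)"
        have "\<beta> * s = - (\<beta> * c) / (E * c\<^sup>2)" using E c0 by (simp add: s_def power2_eq_square)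
        also have "\<dots> > 0" using 1 E c0 by (intro divide_pos_pos) auto
        finally have s: "s \<in> P" by (simp add: P_def)
        have "1 / (E * s) = - c" using E c0 by (simp add: s_def)
        then have "1 / \<phi> s = 0" using c[OF s] by simp
        then show False using \<phi>_pos[OF s] by simp
      next
        case 2
        have "\<beta> * (1 / c) = \<beta> * c / c\<^sup>2" using c0 by (simp add: power2_eq_square)
        also have "\<dots> > 0" using 2 c0 by (intro divide_pos_pos) auto
        finally have "1 / c \<in> P" by (simp add: P_def)
        from surj[OF dom[OF this]] obtain s t where s: "\<alpha> * t + \<beta> * s > 0" "\<phi> s = 1 / c" by blast
        then have "s \<in> P" using \<open>\<alpha> = 0\<close> by (simp add: P_def)
        moreover from c[OF this] s have "1 / (E * s) = 0" by simp
        ultimately show False using E by (auto simp: P_def)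
      qed
    qed
    have "\<phi> s = E * s + 0" if "\<alpha> * t + \<beta> * s > 0" for s t
    proof -
      have "s \<in> P" using that 2 by (simp add: P_def)
      from c[OF this] \<phi>_pos[OF this] show ?thesis using \<open>c = 0\<close> E
        by (metis add.right_neutral divide_divide_eq_right div_by_1 mult_1)
    qed
    then show ?thesis by (rule that)
  next
    case 3
    define F where "F s = sqrt (\<phi>' s)" for s
    define E where "E t = sqrt (\<psi>' t)" for t
    have all: "\<exists>t. \<alpha> * t + \<beta> * s > 0" for s
      using common_transversals[OF 3(1), of "\<bar>s\<bar>" \<beta>] by (metis order_refl)
    have F: "F s > 0" for s using all[of s] dpos by (auto simp: F_def)
    have root: "F s * (E t * (\<alpha> * t + \<beta> * s)) = \<alpha> * \<psi> t + \<beta> * \<phi> s" if "\<alpha> * t + \<beta> * s > 0" for s t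
    proof (rule power2_eq_imp_eq)
      show "(F s * (E t * (\<alpha> * t + \<beta> * s)))\<^sup>2 = (\<alpha> * \<psi> t + \<beta> * \<phi> s)\<^sup>2"
        using eq[OF that] dpos[OF that] by (simp add: F_def E_def power_mult_distrib)
      show "0 \<le> F s * (E t * (\<alpha> * t + \<beta> * s))" using F[of s] that dpos[OF that] by (simp add: E_def)
      show "0 \<le> \<alpha> * \<psi> t + \<beta> * \<phi> s" using pos[OF that] by simp
    qed
    have line: "1 / F s = 1 / F 0 + (1 / F 1 - 1 / F 0) * s" for s
    proof -
      obtain t1 t2 where t: "t1 < t2"
        "\<And>x. \<bar>x\<bar> \<le> \<bar>s\<bar> + 1 \<Longrightarrow> \<alpha> * t1 + \<beta> * x > 0" "\<And>x. \<bar>x\<bar> \<le> \<bar>s\<bar> + 1 \<Longrightarrow> \<alpha> * t2 + \<beta> * x > 0"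
        using common_transversals[OF 3(1), of "\<bar>s\<bar> + 1" \<beta>] by metis
      define K where "K = \<alpha> * (\<psi> t1 - \<psi> t2)"
      have "\<psi> t1 < \<psi> t2" using inj[OF t(2)[of 0] t(3)[of 0]] t(1) by simp
      then have K: "K \<noteq> 0" using 3 by (simp add: K_def)
      define a b where "a = \<alpha> * (E t1 * t1 - E t2 * t2)" and "b = \<beta> * (E t1 - E t2)"
      have "1 / F x = a / K + b / K * x" if "\<bar>x\<bar> \<le> \<bar>s\<bar> + 1" for x
      proof -
        have "F x * (a + b * x) = K"
          using root[OF t(2)[OF that]] root[OF t(3)[OF that]] unfolding a_def b_def K_def by algebra
        then show ?thesis using K F[of x] by (simp add: field_simps)
      qed
      from this[of 0] this[of 1] this[of s] show ?thesis by simp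
    qed
    have "1 / F 1 = 1 / F 0"
    proof (rule ccontr)
      assume "1 / F 1 \<noteq> 1 / F 0"
      then have "1 / F (- (1 / F 0) / (1 / F 1 - 1 / F 0)) = 0" by (subst line) simp
      then show False using F by (metis divide_eq_0_iff less_irrefl zero_neq_one)
    qed
    then have "F s = F 0" for s using line[of s] by simp
    then have "\<phi>' s = \<phi>' 0" for s by (simp add: F_def)
    then show ?thesis using affine all by blast
  qed
qed

text \<open>
  Both components are affine by the previous lemma, which is symmetric in the two coordinates.
  Comparing coefficients forces equal slopes and a translation part parallel to the boundary of
  the half-plane.
\<close>

lemma conformal_factor_preserving_is_homothety:
  fixes \<phi> \<phi>' \<psi> \<psi>' :: "real \<Rightarrow> real"
  assumes ne: "\<alpha> \<noteq> 0 \<or> \<beta> \<noteq> 0"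
    and pos: "\<And>s t. \<alpha> * t + \<beta> * s > 0 \<Longrightarrow> \<alpha> * \<psi> t + \<beta> * \<phi> s > 0"
    and deriv: "\<And>s t. \<alpha> * t + \<beta> * s > 0 \<Longrightarrow> (\<phi> has_real_derivative \<phi>' s) (at s)"
      "\<And>s t. \<alpha> * t + \<beta> * s > 0 \<Longrightarrow> (\<psi> has_real_derivative \<psi>' t) (at t)"
    and dpos: "\<And>s t. \<alpha> * t + \<beta> * s > 0 \<Longrightarrow> \<phi>' s > 0 \<and> \<psi>' t > 0"
    and mono: "\<And>s t s' t'. \<alpha> * t + \<beta> * s > 0 \<Longrightarrow> \<alpha> * t' + \<beta> * s' > 0 \<Longrightarrow> s < s' \<Longrightarrow> \<phi> s < \<phi> s'"
      "\<And>s t s' t'. \<alpha> * t + \<beta> * s > 0 \<Longrightarrow> \<alpha> * t' + \<beta> * s' > 0 \<Longrightarrow> t < t' \<Longrightarrow> \<psi> t < \<psi> t'"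
    and surj: "\<And>s t. \<alpha> * t + \<beta> * s > 0 \<Longrightarrow> \<exists>s' t'. \<alpha> * t' + \<beta> * s' > 0 \<and> \<phi> s' = s \<and> \<psi> t' = t"
    and eq: "\<And>s t. \<alpha> * t + \<beta> * s > 0 \<Longrightarrow>
      \<phi>' s * \<psi>' t * (\<alpha> * t + \<beta> * s)\<^sup>2 = (\<alpha> * \<psi> t + \<beta> * \<phi> s)\<^sup>2"
  obtains \<kappa> \<mu> \<nu> where "\<kappa> > 0" "\<alpha> * \<nu> + \<beta> * \<mu> = 0"
    "\<And>s t. \<alpha> * t + \<beta> * s > 0 \<Longrightarrow> \<phi> s = \<kappa> * s + \<mu> \<and> \<psi> t = \<kappa> * t + \<nu>"
proof -
  have surj1: "\<exists>s' t'. \<alpha> * t' + \<beta> * s' > 0 \<and> \<phi> s' = s" if "\<alpha> * t + \<beta> * s > 0" for s t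
    using surj[OF that] by blast
  obtain \<kappa>1 \<mu> where \<phi>: "\<And>s t. \<alpha> * t + \<beta> * s > 0 \<Longrightarrow> \<phi> s = \<kappa>1 * s + \<mu>"
    by (rule conformal_factor_component_affine[of \<alpha> \<beta> \<psi> \<phi> \<phi>' \<psi>', OF ne pos deriv(1) dpos mono(2) surj1 eq]) blast+
  have swap: "\<beta> * s + \<alpha> * t > 0 \<longleftrightarrow> \<alpha> * t + \<beta> * s > 0" for s t by (simp add: add.commute)
  have "\<exists>\<kappa> \<mu>. \<forall>t s. \<beta> * s + \<alpha> * t > 0 \<longrightarrow> \<psi> t = \<kappa> * t + \<mu>"
  proof (rule conformal_factor_component_affine[of \<beta> \<alpha> \<phi> \<psi> \<psi>' \<phi>'], unfold swap)
    show "\<beta> \<noteq> 0 \<or> \<alpha> \<noteq> 0" using ne by blast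
    show "\<alpha> * \<psi> t + \<beta> * \<phi> s > 0" if "\<alpha> * t + \<beta> * s > 0" for s t using pos[OF that] .
    show "(\<psi> has_real_derivative \<psi>' t) (at t)" if "\<alpha> * t + \<beta> * s > 0" for s t using deriv(2)[OF that] .
    show "\<psi>' t > 0 \<and> \<phi>' s > 0" if "\<alpha> * t + \<beta> * s > 0" for s t using dpos[OF that] by simp
    show "\<phi> s < \<phi> s'" if "\<alpha> * t + \<beta> * s > 0" "\<alpha> * t + \<beta> * s' > 0" "s < s'" for s s' t using mono(1)[OF that] .
    show "\<exists>t' s'. \<alpha> * t' + \<beta> * s' > 0 \<and> \<psi> t' = t" if "\<alpha> * t + \<beta> * s > 0" for s t using surj[OF that] by blast
    show "\<psi>' t * \<phi>' s * (\<beta> * s + \<alpha> * t)\<^sup>2 = (\<beta> * \<phi> s + \<alpha> * \<psi> t)\<^sup>2" if "\<alpha> * t + \<beta> * s > 0" for s t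
      using eq[OF that] by (simp add: ac_simps)
  qed blast
  then obtain \<kappa>2 \<nu> where \<psi>: "\<And>s t. \<alpha> * t + \<beta> * s > 0 \<Longrightarrow> \<psi> t = \<kappa>2 * t + \<nu>"
    unfolding swap by blast
  have op: "open {s. \<alpha> * t + \<beta> * s > 0}" "open {t. \<alpha> * t + \<beta> * s > 0}" for s t
    by (intro open_Collect_less continuous_intros)+
  have d1: "\<phi>' s = \<kappa>1" if "\<alpha> * t + \<beta> * s > 0" for s t
  proof (rule DERIV_unique[OF deriv(1)[OF that]])
    have "((\<lambda>s. \<kappa>1 * s + \<mu>) has_real_derivative \<kappa>1) (at s)" by (auto intro!: derivative_eq_intros)
    then show "(\<phi> has_real_derivative \<kappa>1) (at s)"
      by (rule has_field_derivative_transform_within_open[OF _ op(1)[of t]]) (use that \<phi> in auto)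
  qed
  have d2: "\<psi>' t = \<kappa>2" if "\<alpha> * t + \<beta> * s > 0" for s t
  proof (rule DERIV_unique[OF deriv(2)[OF that]])
    have "((\<lambda>s. \<kappa>2 * s + \<nu>) has_real_derivative \<kappa>2) (at t)" by (auto intro!: derivative_eq_intros)
    then show "(\<psi> has_real_derivative \<kappa>2) (at t)"
      by (rule has_field_derivative_transform_within_open[OF _ op(2)[of s]]) (use that \<psi> in auto)
  qed
  have p0: "\<alpha> * \<alpha> + \<beta> * \<beta> > 0" using ne
    by (metis add_cancel_right_right not_sum_squares_lt_zero sum_squares_gt_zero_iff)
  have l: "\<kappa>1 > 0" "\<kappa>2 > 0" using dpos[OF p0] d1[OF p0] d2[OF p0] by auto
  \<comment> \<open>The common value of the two slopes will be their geometric mean.\<close>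
  define r where "r = sqrt (\<kappa>1 * \<kappa>2)"
  have r: "r > 0" "r\<^sup>2 = \<kappa>1 * \<kappa>2" using l by (auto simp: r_def)
  have "(\<alpha> * (\<kappa>2 - r)) * t + (\<beta> * (\<kappa>1 - r)) * s + (\<alpha> * \<nu> + \<beta> * \<mu>) = 0"
    if st: "\<alpha> * t + \<beta> * s > 0" for s t
  proof -
    have "r * (\<alpha> * t + \<beta> * s) = \<alpha> * \<psi> t + \<beta> * \<phi> s"
    proof (rule power2_eq_imp_eq)
      show "(r * (\<alpha> * t + \<beta> * s))\<^sup>2 = (\<alpha> * \<psi> t + \<beta> * \<phi> s)\<^sup>2"
        using eq[OF st] d1[OF st] d2[OF st] r by (simp add: power_mult_distrib)
    qed (use st r pos[OF st] in auto)
    then show ?thesis using \<phi>[OF st] \<psi>[OF st] by (simp add: algebra_simps)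
  qed
  from affine_zero_on_half_plane[OF ne this]
  have 0: "\<alpha> * (\<kappa>2 - r) = 0" "\<beta> * (\<kappa>1 - r) = 0" "\<alpha> * \<nu> + \<beta> * \<mu> = 0" by auto
  have "\<kappa>1 = \<kappa>2"
    using ne 0 r l by (auto simp: power2_eq_square)
  then show ?thesis using that[of \<kappa>1 \<nu> \<mu>] \<phi> \<psi> 0 l by blast
qed

section \<open>Null coordinates\<close>

locale left_invariant_lorentzian =
  fixes A :: "real^2^2"
  assumes det_pos: "det A > 0"
begin

text \<open>
  The functionals \<open>v\<^sub>1 - v\<^sub>2\<close> and \<open>v\<^sub>1 + v\<^sub>2\<close>, multiplied by \<open>y\<close>. As linear functions on the plane
  they are null coordinates: their level lines are the two families of lightlike lines.
\<close>

definition \<xi> :: "real \<times> real \<Rightarrow> real" where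
  "\<xi> w = (A$1$1 - A$2$1) * fst w + (A$1$2 - A$2$2) * snd w"

definition \<eta> :: "real \<times> real \<Rightarrow> real" where
  "\<eta> w = (A$1$1 + A$2$1) * fst w + (A$1$2 + A$2$2) * snd w"

text \<open>
  The coefficients that express \<open>y\<close> through the null coordinates: \<open>y = \<alpha> * \<eta> + \<beta> * \<xi>\<close>.
\<close>

definition \<alpha> :: real where "\<alpha> = (A$1$1 - A$2$1) / (2 * det A)"

definition \<beta> :: real where "\<beta> = - (A$1$1 + A$2$1) / (2 * det A)"

text \<open>
  The inverse of the null coordinate map.
\<close>

definition point :: "real \<Rightarrow> real \<Rightarrow> real \<times> real" where
  "point s t = (((A$1$2 + A$2$2) * s - (A$1$2 - A$2$2) * t) / (2 * det A), \<alpha> * t + \<beta> * s)"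

lemma snd_point [simp]: "snd (point s t) = \<alpha> * t + \<beta> * s"
  by (simp add: point_def)

lemma det_\<alpha>_\<beta>: "2 * det A * \<alpha> = A$1$1 - A$2$1" "2 * det A * \<beta> = - (A$1$1 + A$2$1)"
  using det_pos by (simp_all add: \<alpha>_def \<beta>_def)

lemma det_fst_point:
  "2 * det A * fst (point s t) = (A$1$2 + A$2$2) * s - (A$1$2 - A$2$2) * t"
  using det_pos by (simp add: point_def)

lemma snd_eq: "snd w = \<alpha> * \<eta> w + \<beta> * \<xi> w"
proof -
  have "2 * det A * snd w = 2 * det A * (\<alpha> * \<eta> w + \<beta> * \<xi> w)"
    using det_\<alpha>_\<beta> det_2[of A] unfolding \<xi>_def \<eta>_def by algebra
  then show ?thesis using det_pos by simp
qed

lemma point_null_coords [simp]: "point (\<xi> w) (\<eta> w) = w"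
proof (rule prod_eqI)
  have "2 * det A * fst (point (\<xi> w) (\<eta> w)) = 2 * det A * fst w"
    using det_fst_point[of "\<xi> w" "\<eta> w"] det_2[of A] unfolding \<xi>_def \<eta>_def by algebra
  then show "fst (point (\<xi> w) (\<eta> w)) = fst w" using det_pos by simp
qed (simp only: snd_point snd_eq[symmetric])

lemma null_coords_inject: "\<xi> v = \<xi> w \<Longrightarrow> \<eta> v = \<eta> w \<Longrightarrow> v = w"
  by (metis point_null_coords)

lemma \<xi>_point [simp]: "\<xi> (point s t) = s"
proof -
  have "2 * det A * \<xi> (point s t) = 2 * det A * s"
    using det_\<alpha>_\<beta> det_fst_point[of s t] det_2[of A] unfolding \<xi>_def snd_point by algebra
  then show ?thesis using det_pos by simp
qed

lemma \<eta>_point [simp]: "\<eta> (point s t) = t"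
proof -
  have "2 * det A * \<eta> (point s t) = 2 * det A * t"
    using det_\<alpha>_\<beta> det_fst_point[of s t] det_2[of A] unfolding \<eta>_def snd_point by algebra
  then show ?thesis using det_pos by simp
qed

lemma \<alpha>_\<beta>_nonzero: "\<alpha> \<noteq> 0 \<or> \<beta> \<noteq> 0"
  using snd_eq[of "(0, 1)"] by auto

definition half_plane :: "real \<Rightarrow> real \<Rightarrow> bool" where
  "half_plane s t \<longleftrightarrow> \<alpha> * t + \<beta> * s > 0"

lemma half_plane_iff [simp]: "point s t \<in> aff_plus \<longleftrightarrow> half_plane s t"
  by (simp add: aff_plus_def half_plane_def)

lemma point_in_aff_plus: "half_plane s t \<Longrightarrow> point s t \<in> aff_plus"
  by simp

lemma in_aff_plus_iff: "w \<in> aff_plus \<longleftrightarrow> half_plane (\<xi> w) (\<eta> w)"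
  by (simp add: aff_plus_def half_plane_def snd_eq)

lemma open_half_plane: "open {s. half_plane s t}" "open {t. half_plane s t}"
  unfolding half_plane_def by (intro open_Collect_less continuous_intros)+

lemma bounded_linear_\<xi>: "bounded_linear \<xi>"
  unfolding \<xi>_def[abs_def]
  by (intro bounded_linear_add bounded_linear_mult_right bounded_linear_compose[OF bounded_linear_mult_right]
      bounded_linear_fst bounded_linear_snd)

lemma bounded_linear_\<eta>: "bounded_linear \<eta>"
  unfolding \<eta>_def[abs_def]
  by (intro bounded_linear_add bounded_linear_compose[OF bounded_linear_mult_right]
      bounded_linear_fst bounded_linear_snd)

lemma null_coords_linear [simp]:
  "\<xi> (v + w) = \<xi> v + \<xi> w" "\<eta> (v + w) = \<eta> v + \<eta> w"
  "\<xi> (v - w) = \<xi> v - \<xi> w" "\<eta> (v - w) = \<eta> v - \<eta> w"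
  "\<xi> (c *\<^sub>R w) = c * \<xi> w" "\<eta> (c *\<^sub>R w) = c * \<eta> w"
  by (simp_all add: \<xi>_def \<eta>_def algebra_simps)

lemma frame_vec_eq:
  "frame_vec A q w $ 1 = (\<xi> w + \<eta> w) / (2 * snd q)"
  "frame_vec A q w $ 2 = (\<eta> w - \<xi> w) / (2 * snd q)"
  by (simp_all add: frame_vec_def matrix_vector_mult_def sum_2 \<xi>_def \<eta>_def
      add_divide_distrib diff_divide_distrib algebra_simps)

lemma future_nonspacelike_iff:
  assumes "snd q > 0"
  shows "future_nonspacelike A q w \<longleftrightarrow> 0 \<le> \<xi> w \<and> 0 \<le> \<eta> w"
  using assms by (simp add: future_nonspacelike_def frame_vec_eq abs_le_iff divide_right_mono field_simps)

lemma speed_eq: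
  assumes "snd q > 0"
  shows "sqrt ((frame_vec A q w $ 1)\<^sup>2 - (frame_vec A q w $ 2)\<^sup>2) = sqrt (\<xi> w * \<eta> w) / snd q"
proof -
  have "(frame_vec A q w $ 1)\<^sup>2 - (frame_vec A q w $ 2)\<^sup>2 = \<xi> w * \<eta> w / (snd q)\<^sup>2"
    using assms by (simp add: frame_vec_eq power2_eq_square field_simps)
  then show ?thesis using assms by (simp add: real_sqrt_divide)
qed

lemma metric_eq: "metric A q v w = - (\<xi> v * \<eta> w + \<eta> v * \<xi> w) / (2 * (snd q)\<^sup>2)"
  by (cases "snd q = 0") (simp_all add: metric_def frame_vec_eq power2_eq_square field_simps)

end

section \<open>Estimates for the Lorentzian distance\<close>

context left_invariant_lorentzian
begin

text \<open>
  A linear functional that is nonnegative on the future cone increases along every future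
  directed curve, by the fundamental theorem of calculus for Lipschitz functions. The null
  coordinates are such functionals.
\<close>

lemma curve_functional:
  assumes adm: "admissible_curve A p q T \<gamma>" and L: "bounded_linear L"
    and nonneg: "\<And>z w. snd z > 0 \<Longrightarrow> future_nonspacelike A z w \<Longrightarrow> (0::real) \<le> L w"
  shows "((\<lambda>t. L (vector_derivative \<gamma> (at t within {0..T}))) has_integral L q - L p) {0..T}"
    and "\<And>t. t \<in> {0..T} \<Longrightarrow> L p \<le> L (\<gamma> t) \<and> L (\<gamma> t) \<le> L q"
    and "AE t in lebesgue. t \<in> {0..T} \<longrightarrow> 0 \<le> L (vector_derivative \<gamma> (at t within {0..T}))"
proof -
  let ?v = "\<lambda>t. vector_derivative \<gamma> (at t within {0..T})"
  from adm obtain C where T: "0 \<le> T" and in_G: "\<gamma> ` {0..T} \<subseteq> aff_plus" and ends: "\<gamma> 0 = p" "\<gamma> T = q"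
    and lip: "C-lipschitz_on {0..T} \<gamma>"
    and ae: "AE t in lebesgue. t \<in> {0..T} \<longrightarrow> \<gamma> differentiable (at t within {0..T}) \<and>
        future_nonspacelike A (\<gamma> t) (?v t)"
    unfolding admissible_curve_def by blast
  have snd_pos: "snd (\<gamma> t) > 0" if "t \<in> {0..T}" for t
    using in_G that by (auto simp: aff_plus_def image_subset_iff)
  show ae0: "AE t in lebesgue. t \<in> {0..T} \<longrightarrow> 0 \<le> L (?v t)"
    using ae by eventually_elim (use nonneg snd_pos in blast)
  obtain K where "K-lipschitz_on UNIV L" "0 \<le> K"
    using bounded_linear.lipschitz_boundE[OF L] by (metis lipschitz_on_nonneg)
  then have lipL: "(K * C)-lipschitz_on {0..T} (\<lambda>t. L (\<gamma> t))"
    using lipschitz_on_compose2[OF lip, of K L] lipschitz_on_subset by blast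
  have I: "((\<lambda>t. L (?v t)) has_integral L (\<gamma> b) - L (\<gamma> a)) {a..b}"
    if "a \<in> {0..T}" "b \<in> {0..T}" "a \<le> b" for a b
  proof (rule has_integral_derivative_lipschitz)
    have sub: "{a..b} \<subseteq> {0..T}" using that by auto
    show "(K * C)-lipschitz_on {a..b} (\<lambda>t. L (\<gamma> t))" by (rule lipschitz_on_subset[OF lipL sub])
    show "AE t in lebesgue. t \<in> {a..b} \<longrightarrow>
        ((\<lambda>t. L (\<gamma> t)) has_real_derivative L (?v t)) (at t within {a..b})"
      using ae
    proof eventually_elim
      case (elim t)
      show ?case
      proof
        assume "t \<in> {a..b}"
        then have "(\<gamma> has_vector_derivative ?v t) (at t within {0..T})"
          using elim sub by (auto simp: vector_derivative_works)
        then have "((\<lambda>t. L (\<gamma> t)) has_vector_derivative L (?v t)) (at t within {0..T})"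
          by (rule bounded_linear.has_vector_derivative[OF L])
        then show "((\<lambda>t. L (\<gamma> t)) has_real_derivative L (?v t)) (at t within {a..b})"
          using sub by (simp add: has_real_derivative_iff_has_vector_derivative has_vector_derivative_within_subset)
      qed
    qed
  qed fact
  show "((\<lambda>t. L (?v t)) has_integral L q - L p) {0..T}" using I[of 0 T] T ends by simp
  obtain N where N: "negligible N" "\<And>t. t \<notin> N \<Longrightarrow> t \<in> {0..T} \<Longrightarrow> 0 \<le> L (?v t)"
    using ae0 unfolding eventually_ae_filter_negligible by (auto simp: subset_iff)
  have mono: "L (\<gamma> a) \<le> L (\<gamma> b)" if ab: "a \<in> {0..T}" "b \<in> {0..T}" "a \<le> b" for a b
  proof -
    have "((\<lambda>t. max 0 (L (?v t))) has_integral L (\<gamma> b) - L (\<gamma> a)) {a..b}"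
      by (rule has_integral_spike[OF N(1) _ I[OF ab]]) (use N(2) ab in auto)
    then have "0 \<le> L (\<gamma> b) - L (\<gamma> a)" by (rule has_integral_nonneg) auto
    then show ?thesis by simp
  qed
  show "L p \<le> L (\<gamma> t) \<and> L (\<gamma> t) \<le> L q" if "t \<in> {0..T}" for t
    using mono[of 0 t] mono[of t T] that T ends by auto
qed

lemmas curve_\<xi> = curve_functional[OF _ bounded_linear_\<xi>]
lemmas curve_\<eta> = curve_functional[OF _ bounded_linear_\<eta>]

text \<open>
  The length element is a geometric mean of \<open>d\<xi>\<close> and \<open>d\<eta>\<close>, divided by the height; the weighted
  inequality between geometric and arithmetic mean makes it linear, and the total increments of
  the null coordinates are known. The weight \<open>r\<close> is free.
\<close>

lemma curve_length_le:
  assumes adm: "admissible_curve A p q T \<gamma>"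
    and m: "m > 0" "\<And>t. t \<in> {0..T} \<Longrightarrow> m \<le> snd (\<gamma> t)" and r: "r > 0"
  shows "curve_length A T \<gamma> \<le> ennreal ((r * (\<xi> q - \<xi> p) + (\<eta> q - \<eta> p) / r) / (2 * m))"
proof -
  let ?v = "\<lambda>t. vector_derivative \<gamma> (at t within {0..T})"
  let ?B = "\<lambda>t. (r * \<xi> (?v t) + \<eta> (?v t) / r) / (2 * m)"
  have x: "((\<lambda>t. \<xi> (?v t)) has_integral \<xi> q - \<xi> p) {0..T}"
    "AE t in lebesgue. t \<in> {0..T} \<longrightarrow> 0 \<le> \<xi> (?v t)"
    using curve_\<xi>[OF adm] future_nonspacelike_iff by blast+
  have e: "((\<lambda>t. \<eta> (?v t)) has_integral \<eta> q - \<eta> p) {0..T}"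
    "AE t in lebesgue. t \<in> {0..T} \<longrightarrow> 0 \<le> \<eta> (?v t)"
    using curve_\<eta>[OF adm] future_nonspacelike_iff by blast+
  have B_int: "(?B has_integral (r * (\<xi> q - \<xi> p) + (\<eta> q - \<eta> p) / r) / (2 * m)) {0..T}"
    by (intro has_integral_divide has_integral_add has_integral_mult_right x e)
  have ae: "AE t in lebesgue. t \<in> {0..T} \<longrightarrow> 0 \<le> ?B t \<and> sqrt (\<xi> (?v t) * \<eta> (?v t)) / snd (\<gamma> t) \<le> ?B t"
    using x(2) e(2)
  proof eventually_elim
    case (elim t)
    show ?case
    proof
      assume t: "t \<in> {0..T}"
      have n: "0 \<le> \<xi> (?v t)" "0 \<le> \<eta> (?v t)" using elim t by auto
      have B0: "0 \<le> ?B t" using n m r by simp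
      have "sqrt (\<xi> (?v t) * \<eta> (?v t)) = sqrt ((r * \<xi> (?v t)) * (\<eta> (?v t) / r))" using r by simp
      also have "\<dots> \<le> (r * \<xi> (?v t) + \<eta> (?v t) / r) / 2"
        using n r by (intro arith_geo_mean_sqrt) auto
      finally have "sqrt (\<xi> (?v t) * \<eta> (?v t)) / snd (\<gamma> t) \<le> (r * \<xi> (?v t) + \<eta> (?v t) / r) / 2 / m"
        using m(1) m(2)[OF t] n r by (intro frac_le) auto
      then show "0 \<le> ?B t \<and> sqrt (\<xi> (?v t) * \<eta> (?v t)) / snd (\<gamma> t) \<le> ?B t" using B0 by simp
    qed
  qed
  obtain N where N: "negligible N" "\<And>t. t \<notin> N \<Longrightarrow> t \<in> {0..T} \<Longrightarrow> 0 \<le> ?B t"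
    using ae unfolding eventually_ae_filter_negligible by (auto simp: subset_iff)
  have B_int': "((\<lambda>t. max 0 (?B t)) has_integral (r * (\<xi> q - \<xi> p) + (\<eta> q - \<eta> p) / r) / (2 * m)) {0..T}"
    by (rule has_integral_spike[OF N(1) _ B_int]) (use N(2) in auto)
  have "curve_length A T \<gamma> \<le> (\<integral>\<^sup>+ t. ennreal (max 0 (?B t)) * indicator {0..T} t \<partial>lebesgue)"
    unfolding curve_length_def
  proof (rule nn_integral_mono_AE)
    show "AE t in lebesgue. ennreal (let v = frame_vec A (\<gamma> t) (?v t) in sqrt ((v $ 1)\<^sup>2 - (v $ 2)\<^sup>2)) * indicator {0..T} t
        \<le> ennreal (max 0 (?B t)) * indicator {0..T} t"
      using ae
    proof eventually_elim
      case (elim t)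
      show ?case
      proof (cases "t \<in> {0..T}")
        case True
        have "snd (\<gamma> t) > 0" using m(1) m(2)[OF True] by linarith
        then show ?thesis using elim True by (simp add: Let_def speed_eq ennreal_leI)
      qed simp
    qed
  qed
  also have "\<dots> = ennreal ((r * (\<xi> q - \<xi> p) + (\<eta> q - \<eta> p) / r) / (2 * m))"
    unfolding nn_integral_completion by (rule nn_integral_has_integral_lebesgue'[OF _ B_int']) simp
  finally show ?thesis .
qed

text \<open>
  The optimal weight is the square root of the ratio of the two increments.
\<close>

lemma lorentz_dist_le:
  assumes less: "\<xi> p < \<xi> q" "\<eta> p < \<eta> q" and m: "m > 0"
    and below: "\<And>z. z \<in> aff_plus \<Longrightarrow> \<xi> p \<le> \<xi> z \<Longrightarrow> \<xi> z \<le> \<xi> q \<Longrightarrow> \<eta> p \<le> \<eta> z \<Longrightarrow> \<eta> z \<le> \<eta> q \<Longrightarrow> m \<le> snd z"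
  shows "lorentz_dist A p q \<le> ennreal (sqrt ((\<xi> q - \<xi> p) * (\<eta> q - \<eta> p)) / m)"
  unfolding lorentz_dist_def
proof (rule Sup_least, clarsimp)
  fix T \<gamma> assume adm: "admissible_curve A p q T \<gamma>"
  define h k where "h = \<xi> q - \<xi> p" and "k = \<eta> q - \<eta> p"
  have hk: "h > 0" "k > 0" using less by (auto simp: h_def k_def)
  define r where "r = sqrt k / sqrt h"
  have r: "r > 0" using hk by (simp add: r_def)
  have "m \<le> snd (\<gamma> t)" if t: "t \<in> {0..T}" for t
  proof (rule below)
    show "\<gamma> t \<in> aff_plus" using adm t by (auto simp: admissible_curve_def)
  qed (use curve_\<xi>(2)[OF adm _ t] curve_\<eta>(2)[OF adm _ t] future_nonspacelike_iff in blast)+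
  from curve_length_le[OF adm m this r]
  have "curve_length A T \<gamma> \<le> ennreal ((r * h + k / r) / (2 * m))" by (simp add: h_def k_def)
  moreover have "r * h = sqrt (h * k)" "k / r = sqrt (h * k)"
    using hk by (simp_all add: r_def real_sqrt_mult field_simps)
  ultimately show "curve_length A T \<gamma> \<le> ennreal (sqrt ((\<xi> q - \<xi> p) * (\<eta> q - \<eta> p)) / m)"
    by (simp add: h_def k_def)
qed

text \<open>
  The straight segment has at least this length.
\<close>

lemma lorentz_dist_ge:
  assumes p: "p \<in> aff_plus" and q: "q \<in> aff_plus" and less: "\<xi> p < \<xi> q" "\<eta> p < \<eta> q"
    and M: "snd p \<le> M" "snd q \<le> M"
  shows "ennreal (sqrt ((\<xi> q - \<xi> p) * (\<eta> q - \<eta> p)) / M) \<le> lorentz_dist A p q"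
proof -
  define \<gamma> where "\<gamma> t = p + t *\<^sub>R (q - p)" for t :: real
  have d: "(\<gamma> has_vector_derivative q - p) (at t within {0..1})" for t
    unfolding \<gamma>_def by (auto intro!: derivative_eq_intros)
  have vd: "vector_derivative \<gamma> (at t within {0..1}) = q - p" if "t \<in> {0..1}" for t
    using d that by (intro vector_derivative_within_cbox[of 0 1, unfolded cbox_interval]) auto
  have snd_\<gamma>: "snd (\<gamma> t) = (1 - t) * snd p + t * snd q" for t by (simp add: \<gamma>_def algebra_simps)
  have pos: "snd (\<gamma> t) > 0" if "t \<in> {0..1}" for t
  proof (cases "t = 1")
    case False
    then have "(1 - t) * snd p > 0" using that p by (simp add: aff_plus_def)
    moreover have "t * snd q \<ge> 0" using that q by (simp add: aff_plus_def)
    ultimately show ?thesis unfolding snd_\<gamma> by simp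
  qed (use q in \<open>simp add: snd_\<gamma> aff_plus_def\<close>)
  have le: "snd (\<gamma> t) \<le> M" if "t \<in> {0..1}" for t
    unfolding snd_\<gamma> using that M by (intro convex_bound_le) auto
  have adm: "admissible_curve A p q 1 \<gamma>"
    unfolding admissible_curve_def
  proof (intro conjI)
    show "\<gamma> ` {0..1} \<subseteq> aff_plus" using pos by (auto simp: aff_plus_def)
    show "\<exists>C. C-lipschitz_on {0..1} \<gamma>"
    proof
      show "(norm (q - p))-lipschitz_on {0..1} \<gamma>"
        by (rule lipschitz_onI) (auto simp: \<gamma>_def dist_norm scaleR_diff_left[symmetric] mult.commute)
    qed
    show "AE t in lebesgue. t \<in> {0..1} \<longrightarrow> \<gamma> differentiable at t within {0..1} \<and>
       future_nonspacelike A (\<gamma> t) (vector_derivative \<gamma> (at t within {0..1}))"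
      using d vd less pos
      by (intro AE_I2) (auto simp: future_nonspacelike_iff intro: differentiableI_vector)
  qed (auto simp: \<gamma>_def)
  have "ennreal (sqrt ((\<xi> q - \<xi> p) * (\<eta> q - \<eta> p)) / M)
      = (\<integral>\<^sup>+ t. ennreal (sqrt ((\<xi> q - \<xi> p) * (\<eta> q - \<eta> p)) / M) * indicator {0..1::real} t \<partial>lebesgue)"
    by (simp add: nn_integral_cmult_indicator)
  also have "\<dots> \<le> curve_length A 1 \<gamma>"
    unfolding curve_length_def
  proof (rule nn_integral_mono)
    fix t :: real
    show "ennreal (sqrt ((\<xi> q - \<xi> p) * (\<eta> q - \<eta> p)) / M) * indicator {0..1} t \<le>
      ennreal (let v = frame_vec A (\<gamma> t) (vector_derivative \<gamma> (at t within {0..1}))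
               in sqrt ((v $ 1)\<^sup>2 - (v $ 2)\<^sup>2)) * indicator {0..1} t"
    proof (cases "t \<in> {0..1}")
      case True
      have "sqrt ((\<xi> q - \<xi> p) * (\<eta> q - \<eta> p)) / M \<le> sqrt ((\<xi> q - \<xi> p) * (\<eta> q - \<eta> p)) / snd (\<gamma> t)"
        using pos[OF True] le[OF True] less by (intro divide_left_mono) auto
      then show ?thesis using True pos[OF True] by (simp add: Let_def speed_eq vd ennreal_leI)
    qed simp
  qed
  also have "\<dots> \<le> lorentz_dist A p q"
    unfolding lorentz_dist_def using adm by (intro Sup_upper) blast
  finally show ?thesis .
qed

text \<open>
  The Lorentzian distance determines the chronological order, which in null coordinates is the
  strict product order. If one increment vanishes, an extreme choice of the weight in the length
  estimate shows that every causal curve has length zero.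
\<close>

lemma lorentz_dist_pos_iff:
  assumes p: "p \<in> aff_plus" and q: "q \<in> aff_plus"
  shows "0 < lorentz_dist A p q \<longleftrightarrow> \<xi> p < \<xi> q \<and> \<eta> p < \<eta> q"
proof
  assume less: "\<xi> p < \<xi> q \<and> \<eta> p < \<eta> q"
  define M where "M = max (snd p) (snd q)"
  have "M > 0" using p by (auto simp: M_def aff_plus_def)
  then have "0 < ennreal (sqrt ((\<xi> q - \<xi> p) * (\<eta> q - \<eta> p)) / M)"
    using less by (simp add: ennreal_less_zero_iff)
  also have "\<dots> \<le> lorentz_dist A p q"
    using less by (intro lorentz_dist_ge p q) (auto simp: M_def)
  finally show "0 < lorentz_dist A p q" .
next
  assume "0 < lorentz_dist A p q"
  then obtain T \<gamma> where adm: "admissible_curve A p q T \<gamma>" and len: "0 < curve_length A T \<gamma>"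
    unfolding lorentz_dist_def less_Sup_iff by auto
  from adm have T: "0 \<le> T" and ends: "\<gamma> 0 = p" "\<gamma> T = q" and in_G: "\<gamma> ` {0..T} \<subseteq> aff_plus"
    by (auto simp: admissible_curve_def)
  have "continuous_on {0..T} \<gamma>"
    using adm lipschitz_on_continuous_on by (auto simp: admissible_curve_def)
  then have "compact (snd ` \<gamma> ` {0..T})"
    by (intro compact_continuous_image continuous_intros) auto
  then obtain m where m: "m \<in> snd ` \<gamma> ` {0..T}" "\<And>y. y \<in> snd ` \<gamma> ` {0..T} \<Longrightarrow> m \<le> y"
    using compact_attains_inf[of "snd ` \<gamma> ` {0..T}"] T by auto
  have m0: "m > 0" using m(1) in_G by (auto simp: aff_plus_def)
  have m': "m \<le> snd (\<gamma> t)" if "t \<in> {0..T}" for t using m(2) that by blast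
  have le: "\<xi> p \<le> \<xi> q" "\<eta> p \<le> \<eta> q"
    using curve_\<xi>(2)[OF adm _, of T] curve_\<eta>(2)[OF adm _, of T] future_nonspacelike_iff T ends by auto
  note bound = curve_length_le[OF adm m0 m']
  have False if "\<xi> p = \<xi> q \<or> \<eta> p = \<eta> q"
  proof -
    define D where "D = (\<xi> q - \<xi> p) + (\<eta> q - \<eta> p)"
    have D: "D \<ge> 0" using le by (simp add: D_def)
    have "curve_length A T \<gamma> \<le> 0"
    proof (rule ennreal_le_epsilon)
      fix e :: real assume e: "0 < e"
      define r where "r = (D + 1) / (2 * m * e)"
      have r: "r > 0" "1 / r > 0" using D m0 e by (auto simp: r_def)
      have small: "D / r / (2 * m) \<le> e"
      proof -
        have "D / r / (2 * m) = e * (D / (D + 1))" using D m0 e by (simp add: r_def)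
        also have "\<dots> \<le> e" using D e by (intro mult_left_le) auto
        finally show ?thesis .
      qed
      have "curve_length A T \<gamma> \<le> ennreal (D / r / (2 * m))"
        using that
      proof
        assume "\<xi> p = \<xi> q"
        then show ?thesis using bound[OF _ r(1)] by (simp add: D_def)
      next
        assume "\<eta> p = \<eta> q"
        then show ?thesis using bound[OF _ r(2)] by (simp add: D_def)
      qed
      also have "\<dots> \<le> 0 + ennreal e" using small by (simp add: ennreal_leI)
      finally show "curve_length A T \<gamma> \<le> 0 + ennreal e" .
    qed
    then show False using len by simp
  qed
  then show "\<xi> p < \<xi> q \<and> \<eta> p < \<eta> q" using le by force
qed

text \<open>
  On small rectangles the squared distance between opposite corners is the area divided by the
  squared height, up to the oscillation \<open>e\<close> of the height over the rectangle.
\<close>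

lemma lorentz_dist_rectangle:
  assumes h: "s \<noteq> s0" and k: "t \<noteq> t0"
    and e: "e = \<bar>\<alpha>\<bar> * \<bar>t - t0\<bar> + \<bar>\<beta>\<bar> * \<bar>s - s0\<bar>" and y: "y = \<alpha> * t0 + \<beta> * s0" and ey: "e < y"
  defines "a \<equiv> point (min s s0) (min t t0)" and "b \<equiv> point (max s s0) (max t t0)"
  shows "a \<in> aff_plus" "b \<in> aff_plus"
    "ennreal (sqrt (\<bar>s - s0\<bar> * \<bar>t - t0\<bar>) / (y + e)) \<le> lorentz_dist A a b"
    "lorentz_dist A a b \<le> ennreal (sqrt (\<bar>s - s0\<bar> * \<bar>t - t0\<bar>) / (y - e))"
proof -
  have near: "\<bar>\<alpha> * t' + \<beta> * s' - y\<bar> \<le> e" if "\<bar>t' - t0\<bar> \<le> \<bar>t - t0\<bar>" "\<bar>s' - s0\<bar> \<le> \<bar>s - s0\<bar>" for s' t'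
  proof -
    have "\<bar>\<alpha> * t' + \<beta> * s' - y\<bar> = \<bar>\<alpha> * (t' - t0) + \<beta> * (s' - s0)\<bar>" by (simp add: y algebra_simps)
    also have "\<dots> \<le> \<bar>\<alpha>\<bar> * \<bar>t' - t0\<bar> + \<bar>\<beta>\<bar> * \<bar>s' - s0\<bar>" by (simp add: abs_mult[symmetric] abs_triangle_ineq)
    also have "\<dots> \<le> e" unfolding e using that by (intro add_mono mult_left_mono) auto
    finally show ?thesis .
  qed
  have na: "\<bar>snd a - y\<bar> \<le> e" unfolding a_def snd_point by (intro near) (auto simp: min_def)
  have nb: "\<bar>snd b - y\<bar> \<le> e" unfolding b_def snd_point by (intro near) (auto simp: max_def)
  show a: "a \<in> aff_plus" and b: "b \<in> aff_plus" using na nb ey by (auto simp: aff_plus_def)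
  have less: "\<xi> a < \<xi> b" "\<eta> a < \<eta> b" using h k by (auto simp: a_def b_def)
  have diff: "\<xi> b - \<xi> a = \<bar>s - s0\<bar>" "\<eta> b - \<eta> a = \<bar>t - t0\<bar>" by (auto simp: a_def b_def)
  show "ennreal (sqrt (\<bar>s - s0\<bar> * \<bar>t - t0\<bar>) / (y + e)) \<le> lorentz_dist A a b"
    using lorentz_dist_ge[OF a b less, of "y + e"] na nb unfolding diff by linarith
  show "lorentz_dist A a b \<le> ennreal (sqrt (\<bar>s - s0\<bar> * \<bar>t - t0\<bar>) / (y - e))"
    unfolding diff[symmetric]
  proof (rule lorentz_dist_le[OF less])
    show "0 < y - e" using ey by simp
    fix z assume z: "\<xi> a \<le> \<xi> z" "\<xi> z \<le> \<xi> b" "\<eta> a \<le> \<eta> z" "\<eta> z \<le> \<eta> b"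
    have "\<bar>\<alpha> * \<eta> z + \<beta> * \<xi> z - y\<bar> \<le> e"
      by (rule near) (use z in \<open>auto simp: a_def b_def min_def max_def split: if_splits\<close>)
    then show "y - e \<le> snd z" using snd_eq[of z] by linarith
  qed
qed

end

section \<open>Left translations\<close>

lemma aff_mult_eq: "aff_mult q p = (fst q, 0) + snd q *\<^sub>R p"
  by (simp add: aff_mult_def prod_eq_iff)

lemma aff_mult_in_aff_plus: "q \<in> aff_plus \<Longrightarrow> p \<in> aff_plus \<Longrightarrow> aff_mult q p \<in> aff_plus"
  by (simp add: aff_plus_def aff_mult_def)

definition aff_inverse :: "real \<times> real \<Rightarrow> real \<times> real" where
  "aff_inverse q = (- fst q / snd q, 1 / snd q)"

lemma aff_inverse_in_aff_plus: "q \<in> aff_plus \<Longrightarrow> aff_inverse q \<in> aff_plus"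
  by (simp add: aff_plus_def aff_inverse_def)

lemma aff_inverse_mult:
  "q \<in> aff_plus \<Longrightarrow> aff_mult (aff_inverse q) (aff_mult q p) = p"
  "q \<in> aff_plus \<Longrightarrow> aff_mult q (aff_mult (aff_inverse q) p) = p"
  by (simp_all add: aff_plus_def aff_mult_def aff_inverse_def prod_eq_iff field_simps)

lemma left_translation_Bij:
  assumes "q \<in> aff_plus" shows "left_translation q \<in> Bij aff_plus"
proof -
  have "bij_betw (left_translation q) aff_plus aff_plus"
    by (rule bij_betw_byWitness[where f' = "aff_mult (aff_inverse q)"])
      (use assms in \<open>auto simp: left_translation_def aff_inverse_mult aff_mult_in_aff_plus aff_inverse_in_aff_plus\<close>)
  then show ?thesis by (simp add: Bij_def left_translation_def)
qed

context left_invariant_lorentzian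
begin

text \<open>
  Left translations are affine maps of the plane that leave the frame components of tangent
  vectors unchanged.
\<close>

lemma admissible_curve_left_translate:
  assumes q: "q \<in> aff_plus" and adm: "admissible_curve A p p' T \<gamma>"
  shows "admissible_curve A (aff_mult q p) (aff_mult q p') T (\<lambda>t. aff_mult q (\<gamma> t))"
    and "curve_length A T (\<lambda>t. aff_mult q (\<gamma> t)) = curve_length A T \<gamma>"
proof -
  let ?v = "\<lambda>t. vector_derivative \<gamma> (at t within {0..T})"
  let ?\<delta> = "\<lambda>t. aff_mult q (\<gamma> t)"
  from adm obtain C where T: "0 \<le> T" and in_G: "\<gamma> ` {0..T} \<subseteq> aff_plus" and ends: "\<gamma> 0 = p" "\<gamma> T = p'"
    and lip: "C-lipschitz_on {0..T} \<gamma>"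
    and ae: "AE t in lebesgue. t \<in> {0..T} \<longrightarrow> \<gamma> differentiable (at t within {0..T}) \<and>
        future_nonspacelike A (\<gamma> t) (?v t)"
    unfolding admissible_curve_def by blast
  have sq: "snd q > 0" using q by (simp add: aff_plus_def)
  \<comment> \<open>At 0 the derivative within a degenerate interval is not unique, so this point is excluded.\<close>
  have "AE t in lebesgue. t \<noteq> (0::real)"
    using AE_not_in[of "{0::real}" lebesgue] by (simp add: negligible_iff_null_sets[symmetric])
  with ae have ae': "AE t in lebesgue. t \<in> {0..T} \<longrightarrow> ?\<delta> differentiable (at t within {0..T}) \<and>
      future_nonspacelike A (\<gamma> t) (?v t) \<and>
      vector_derivative ?\<delta> (at t within {0..T}) = snd q *\<^sub>R ?v t"
  proof eventually_elim
    case (elim t)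
    show ?case
    proof
      assume t: "t \<in> {0..T}"
      then have "(\<gamma> has_vector_derivative ?v t) (at t within {0..T})"
        using elim by (auto simp: vector_derivative_works)
      then have d: "(?\<delta> has_vector_derivative snd q *\<^sub>R ?v t) (at t within {0..T})"
        unfolding aff_mult_eq by (auto intro!: derivative_eq_intros)
      have "0 < T" using t elim by auto
      then have "vector_derivative ?\<delta> (at t within {0..T}) = snd q *\<^sub>R ?v t"
        using d t by (intro vector_derivative_within_cbox[of 0 T, unfolded cbox_interval])
      then show "?\<delta> differentiable (at t within {0..T}) \<and> future_nonspacelike A (\<gamma> t) (?v t) \<and>
          vector_derivative ?\<delta> (at t within {0..T}) = snd q *\<^sub>R ?v t"
        using d elim t by (auto intro: differentiableI_vector)
    qed
  qed
  have frame: "frame_vec A (aff_mult q z) (snd q *\<^sub>R w) = frame_vec A z w" for z w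
    using sq by (simp add: frame_vec_def aff_mult_def)
  show "admissible_curve A (aff_mult q p) (aff_mult q p') T ?\<delta>"
    unfolding admissible_curve_def
  proof (intro conjI)
    show "?\<delta> ` {0..T} \<subseteq> aff_plus" using in_G aff_mult_in_aff_plus[OF q] by (auto simp del: split_paired_All simp: image_subset_iff)
    have "(\<bar>snd q\<bar> * C)-lipschitz_on {0..T} ?\<delta>"
    proof (rule lipschitz_onI)
      fix s t assume "s \<in> {0..T}" "t \<in> {0..T}"
      have "dist (?\<delta> s) (?\<delta> t) = \<bar>snd q\<bar> * dist (\<gamma> s) (\<gamma> t)"
        by (simp add: aff_mult_eq dist_norm scaleR_diff_right[symmetric])
      also have "\<dots> \<le> \<bar>snd q\<bar> * (C * dist s t)"
        using lipschitz_onD[OF lip \<open>s \<in> {0..T}\<close> \<open>t \<in> {0..T}\<close>] by (intro mult_left_mono) auto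
      finally show "dist (?\<delta> s) (?\<delta> t) \<le> \<bar>snd q\<bar> * C * dist s t" by (simp add: mult.assoc)
    qed (use lipschitz_on_nonneg[OF lip] in simp)
    then show "\<exists>C. C-lipschitz_on {0..T} ?\<delta>" by blast
    show "AE t in lebesgue. t \<in> {0..T} \<longrightarrow> ?\<delta> differentiable (at t within {0..T}) \<and>
        future_nonspacelike A (?\<delta> t) (vector_derivative ?\<delta> (at t within {0..T}))"
      using ae' by eventually_elim (auto simp: future_nonspacelike_def frame)
  qed (use T ends in auto)
  show "curve_length A T ?\<delta> = curve_length A T \<gamma>"
    unfolding curve_length_def
    by (rule nn_integral_cong_AE, use ae' in eventually_elim) (auto simp: frame indicator_def)
qed

lemma lorentz_dist_left_translate:
  assumes q: "q \<in> aff_plus"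
  shows "lorentz_dist A (aff_mult q p) (aff_mult q p') = lorentz_dist A p p'"
proof -
  have le: "lorentz_dist A p p' \<le> lorentz_dist A (aff_mult q p) (aff_mult q p')" if "q \<in> aff_plus" for q p p'
    unfolding lorentz_dist_def
  proof (rule Sup_mono, clarsimp)
    fix T \<gamma> assume "admissible_curve A p p' T \<gamma>"
    from admissible_curve_left_translate[OF that this]
    show "\<exists>l. (\<exists>T' \<gamma>'. l = curve_length A T' \<gamma>' \<and>
        admissible_curve A (aff_mult q p) (aff_mult q p') T' \<gamma>') \<and> curve_length A T \<gamma> \<le> l"
      by (metis order_refl)
  qed
  show ?thesis
    using le[OF q, of p p'] le[OF aff_inverse_in_aff_plus[OF q], of "aff_mult q p" "aff_mult q p'"]
    by (simp add: aff_inverse_mult[OF q])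
qed

lemma left_translation_isometry:
  assumes q: "q \<in> aff_plus" shows "left_translation q \<in> isometries A"
  using left_translation_Bij[OF q] lorentz_dist_left_translate[OF q]
  by (simp add: isometries_def left_translation_def)

end

section \<open>Chronological order and null lines\<close>

context left_invariant_lorentzian
begin

lemma isometryD:
  assumes f: "f \<in> isometries A"
  shows "p \<in> aff_plus \<Longrightarrow> f p \<in> aff_plus"
    and "p \<in> aff_plus \<Longrightarrow> q \<in> aff_plus \<Longrightarrow> lorentz_dist A (f p) (f q) = lorentz_dist A p q"
    and "inj_on f aff_plus" and "f ` aff_plus = aff_plus" and "f \<in> extensional aff_plus"
  using f by (auto simp: isometries_def Bij_def bij_betw_def)

text \<open>
  Isometries are arbitrary bijections here, so this order is the first structure that the
  preservation of the distance gives access to.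
\<close>

lemma isometry_chronological:
  assumes f: "f \<in> isometries A" and p: "p \<in> aff_plus" and q: "q \<in> aff_plus"
  shows "\<xi> (f p) < \<xi> (f q) \<and> \<eta> (f p) < \<eta> (f q) \<longleftrightarrow> \<xi> p < \<xi> q \<and> \<eta> p < \<eta> q"
  using lorentz_dist_pos_iff[OF p q] lorentz_dist_pos_iff[OF isometryD(1)[OF f p] isometryD(1)[OF f q]]
    isometryD(2)[OF f p q] by simp

text \<open>
  The nonstrict product order is determined by the strict one, hence by the distance.
\<close>

lemma causal_iff_chronological_future:
  assumes q: "q \<in> aff_plus"
  shows "\<xi> p \<le> \<xi> q \<and> \<eta> p \<le> \<eta> q \<longleftrightarrow>
    (\<forall>r\<in>aff_plus. \<xi> q < \<xi> r \<and> \<eta> q < \<eta> r \<longrightarrow> \<xi> p < \<xi> r \<and> \<eta> p < \<eta> r)"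
proof
  assume R: "\<forall>r\<in>aff_plus. \<xi> q < \<xi> r \<and> \<eta> q < \<eta> r \<longrightarrow> \<xi> p < \<xi> r \<and> \<eta> p < \<eta> r"
  have sq: "snd q > 0" using q by (simp add: aff_plus_def)
  \<comment> \<open>Moving both null coordinates of \<open>q\<close> up by at most \<open>e0\<close> does not leave the half-plane.\<close>
  define e0 where "e0 = snd q / (\<bar>\<alpha> + \<beta>\<bar> + 1)"
  have e0: "e0 > 0" using sq by (simp add: e0_def)
  have near: "\<xi> p < \<xi> q + e \<and> \<eta> p < \<eta> q + e" if e: "0 < e" "e \<le> e0" for e
  proof -
    have "\<bar>e * (\<alpha> + \<beta>)\<bar> \<le> e0 * \<bar>\<alpha> + \<beta>\<bar>" using e by (simp add: abs_mult mult_right_mono)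
    also have "\<dots> < e0 * (\<bar>\<alpha> + \<beta>\<bar> + 1)" using e0 by simp
    also have "\<dots> = snd q" by (simp add: e0_def)
    finally have "0 < snd q + e * (\<alpha> + \<beta>)" by linarith
    then have "point (\<xi> q + e) (\<eta> q + e) \<in> aff_plus"
      by (simp add: half_plane_def snd_eq algebra_simps)
    then show ?thesis using R e by fastforce
  qed
  have "\<not> \<xi> q < \<xi> p"
  proof
    assume "\<xi> q < \<xi> p"
    then show False using near[of "min e0 (\<xi> p - \<xi> q)"] e0 min.cobounded2[of e0 "\<xi> p - \<xi> q"] by simp
  qed
  moreover have "\<not> \<eta> q < \<eta> p"
  proof
    assume "\<eta> q < \<eta> p"
    then show False using near[of "min e0 (\<eta> p - \<eta> q)"] e0 min.cobounded2[of e0 "\<eta> p - \<eta> q"] by simp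
  qed
  ultimately show "\<xi> p \<le> \<xi> q \<and> \<eta> p \<le> \<eta> q" by simp
qed auto

lemma isometry_causal:
  assumes f: "f \<in> isometries A" and p: "p \<in> aff_plus" and q: "q \<in> aff_plus"
    and le: "\<xi> p \<le> \<xi> q" "\<eta> p \<le> \<eta> q"
  shows "\<xi> (f p) \<le> \<xi> (f q) \<and> \<eta> (f p) \<le> \<eta> (f q)"
proof (subst causal_iff_chronological_future[OF isometryD(1)[OF f q]], rule ballI)
  fix r assume "r \<in> aff_plus"
  then obtain r' where r': "r' \<in> aff_plus" "r = f r'" using isometryD(4)[OF f] by blast
  show "\<xi> (f q) < \<xi> r \<and> \<eta> (f q) < \<eta> r \<longrightarrow> \<xi> (f p) < \<xi> r \<and> \<eta> (f p) < \<eta> r"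
    unfolding r'(2) isometry_chronological[OF f q r'(1)] isometry_chronological[OF f p r'(1)]
    using le by auto
qed

text \<open>
  Two points lie on a common null line if and only if they are causally but not chronologically
  related in one order or the other.
\<close>

lemma isometry_null_related:
  assumes f: "f \<in> isometries A" and p: "p \<in> aff_plus" and q: "q \<in> aff_plus"
    and null: "\<xi> p = \<xi> q \<or> \<eta> p = \<eta> q"
  shows "\<xi> (f p) = \<xi> (f q) \<or> \<eta> (f p) = \<eta> (f q)"
proof -
  have "\<xi> (f p) = \<xi> (f q) \<or> \<eta> (f p) = \<eta> (f q)"
    if "p \<in> aff_plus" "q \<in> aff_plus" "\<xi> p = \<xi> q \<or> \<eta> p = \<eta> q" "\<xi> p \<le> \<xi> q" "\<eta> p \<le> \<eta> q" for p q
    using isometry_causal[OF f that(1,2,4,5)] isometry_chronological[OF f that(1,2)] that(3) by force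
  from this[OF p q] this[OF q p] null show ?thesis by (metis linear)
qed

lemma topspace_isometry_topology [simp]: "topspace (isometry_topology A) = isometries A"
proof -
  have "UNIV \<in> {{f. f ` K \<subseteq> U} | K (U :: (real \<times> real) set). compact K \<and> K \<subseteq> aff_plus \<and> open U}"
    by (rule CollectI, rule exI[of _ "{}"]) auto
  then have "\<Union> {{f. f ` K \<subseteq> U} | K (U :: (real \<times> real) set). compact K \<and> K \<subseteq> aff_plus \<and> open U} = UNIV"
    by blast
  then show ?thesis by (simp add: isometry_topology_def topology_generated_by_topspace)
qed

lemma continuous_map_evaluation:
  assumes p: "p \<in> aff_plus"
  shows "continuous_map (isometry_topology A) euclidean (\<lambda>f. f p)"
  unfolding continuous_map_def
proof (intro conjI allI impI)
  fix U :: "(real \<times> real) set" assume "openin euclidean U"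
  then have "{f. f ` {p} \<subseteq> U} \<in> {{f. f ` K \<subseteq> U} | K U. compact K \<and> K \<subseteq> aff_plus \<and> open U}"
    using p by (intro CollectI exI[of _ "{p}"] exI[of _ U]) auto
  then have "openin (isometry_topology A) ({f. f ` {p} \<subseteq> U} \<inter> isometries A)"
    unfolding isometry_topology_def by (intro openin_subtopology_Int topology_generated_by_Basis)
  moreover have "{f. f ` {p} \<subseteq> U} \<inter> isometries A = {f \<in> topspace (isometry_topology A). f p \<in> U}" by auto
  ultimately show "openin (isometry_topology A) {f \<in> topspace (isometry_topology A). f p \<in> U}" by simp
qed auto

lemma one_isometry_group: "\<one>\<^bsub>isometry_group A\<^esub> = (\<lambda>p\<in>aff_plus. p)"
  by (simp add: isometry_group_def BijGroup_def)

text \<open>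
  Two distinct points on a null line of one family are mapped by an isometry to points on a
  common null line of exactly one of the two families. Both alternatives are closed conditions in
  the compact-open topology, so they are also open, and the alternative that holds for the
  identity holds on its whole connected component.
\<close>

lemma isometries0_preserve_null_coords:
  assumes f: "f \<in> isometries0 A" and p: "p \<in> aff_plus" and q: "q \<in> aff_plus"
  shows "\<xi> p = \<xi> q \<Longrightarrow> \<xi> (f p) = \<xi> (f q)" and "\<eta> p = \<eta> q \<Longrightarrow> \<eta> (f p) = \<eta> (f q)"
proof -
  define X where "X = isometry_topology A"
  obtain C where C: "connectedin X C" "(\<lambda>p\<in>aff_plus. p) \<in> C" "f \<in> C"
    using f unfolding isometries0_def one_isometry_group X_def by (auto simp: connected_component_of_def)
  have "bounded_linear l \<Longrightarrow> closedin X {g \<in> topspace X. l (g p) - l (g q) \<in> {0}}"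
    for l :: "real \<times> real \<Rightarrow> real"
  proof (rule closedin_continuous_map_preimage)
    assume "bounded_linear l"
    then have "continuous_map euclidean euclidean l" by (simp add: linear_continuous_on)
    then have l: "continuous_map X euclideanreal (\<lambda>g. l (g r))" if "r \<in> aff_plus" for r
      using continuous_map_compose[OF continuous_map_evaluation[OF that]] unfolding X_def o_def by blast
    show "continuous_map X euclideanreal (\<lambda>g. l (g p) - l (g q))"
      using l[OF p] l[OF q] by (rule continuous_map_diff)
  qed auto
  from this[OF bounded_linear_\<xi>] this[OF bounded_linear_\<eta>]
  have closed: "closedin X {g \<in> isometries A. \<xi> (g p) = \<xi> (g q)}"
    "closedin X {g \<in> isometries A. \<eta> (g p) = \<eta> (g q)}" by (simp_all add: X_def)
  have exclusive: "\<xi> (g p) = \<xi> (g q) \<longleftrightarrow> \<eta> (g p) \<noteq> \<eta> (g q)"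
    if "p \<noteq> q" "\<xi> p = \<xi> q \<or> \<eta> p = \<eta> q" "g \<in> isometries A" for g
  proof -
    have "g p \<noteq> g q" using isometryD(3)[OF that(3)] p q that(1) by (simp add: inj_on_eq_iff)
    then show ?thesis using isometry_null_related[OF that(3) p q that(2)] null_coords_inject by blast
  qed
  show "\<xi> (f p) = \<xi> (f q)" if eq: "\<xi> p = \<xi> q"
  proof (cases "p = q")
    case False
    have "isometries A - {g \<in> isometries A. \<eta> (g p) = \<eta> (g q)} = {g \<in> isometries A. \<xi> (g p) = \<xi> (g q)}"
      using exclusive[OF False] eq by blast
    then have "openin X {g \<in> isometries A. \<xi> (g p) = \<xi> (g q)}"
      using openin_diff[OF openin_topspace closed(2)] by (simp add: X_def)
    from connectedin_clopen_cases[OF C(1) closed(1) this]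
    have "C \<subseteq> {g \<in> isometries A. \<xi> (g p) = \<xi> (g q)}"
      using C(2) connectedin_subset_topspace[OF C(1)] eq p q by (auto simp: disjnt_iff X_def)
    then show ?thesis using C(3) by blast
  qed simp
  show "\<eta> (f p) = \<eta> (f q)" if eq: "\<eta> p = \<eta> q"
  proof (cases "p = q")
    case False
    have "isometries A - {g \<in> isometries A. \<xi> (g p) = \<xi> (g q)} = {g \<in> isometries A. \<eta> (g p) = \<eta> (g q)}"
      using exclusive[OF False] eq by blast
    then have "openin X {g \<in> isometries A. \<eta> (g p) = \<eta> (g q)}"
      using openin_diff[OF openin_topspace closed(1)] by (simp add: X_def)
    from connectedin_clopen_cases[OF C(1) closed(2) this]
    have "C \<subseteq> {g \<in> isometries A. \<eta> (g p) = \<eta> (g q)}"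
      using C(2) connectedin_subset_topspace[OF C(1)] eq p q by (auto simp: disjnt_iff X_def)
    then show ?thesis using C(3) by blast
  qed simp
qed

end

section \<open>Isometries that are products in null coordinates\<close>

lemma isCont_strict_mono_onto_open:
  fixes f :: "real \<Rightarrow> real"
  assumes P: "open P" "f ` P = P" and mono: "\<And>x y. x \<in> P \<Longrightarrow> y \<in> P \<Longrightarrow> x < y \<Longrightarrow> f x < f y"
    and x: "x \<in> P"
  shows "isCont f x"
proof -
  have "continuous_on P f"
  proof (rule continuous_onI_mono)
    show "f x \<le> f y" if "x \<in> P" "y \<in> P" "x \<le> y" for x y
      using mono[OF that(1,2)] that(3) by (cases "x = y") auto
  qed (use P in simp)
  then show ?thesis using P(1) x continuous_on_eq_continuous_at by blast
qed

text \<open>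
  An isometry that respects both families of null lines is a product map in null coordinates.
\<close>

locale product_isometry = left_invariant_lorentzian +
  fixes f :: "real \<times> real \<Rightarrow> real \<times> real" and \<phi> \<psi> :: "real \<Rightarrow> real"
  assumes isometry: "f \<in> isometries A"
    and prod: "\<And>p. p \<in> aff_plus \<Longrightarrow> \<xi> (f p) = \<phi> (\<xi> p) \<and> \<eta> (f p) = \<psi> (\<eta> p)"
begin

lemma f_point: "half_plane s t \<Longrightarrow> f (point s t) = point (\<phi> s) (\<psi> t)"
  using prod[OF point_in_aff_plus] by (metis point_null_coords \<xi>_point \<eta>_point)

lemma half_plane_image: "half_plane s t \<Longrightarrow> half_plane (\<phi> s) (\<psi> t)"
  using isometryD(1)[OF isometry point_in_aff_plus] f_point by (metis half_plane_iff)

lemma half_plane_onto: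
  assumes st: "half_plane s t"
  shows "\<exists>s' t'. half_plane s' t' \<and> \<phi> s' = s \<and> \<psi> t' = t"
proof -
  obtain p where p: "p \<in> aff_plus" "f p = point s t"
    using isometryD(4)[OF isometry] point_in_aff_plus[OF st] by (metis imageE)
  have "half_plane (\<xi> p) (\<eta> p)" using p(1) by (simp add: in_aff_plus_iff)
  moreover have "\<phi> (\<xi> p) = s" "\<psi> (\<eta> p) = t" using prod[OF p(1)] p(2) by auto
  ultimately show ?thesis by blast
qed

text \<open>
  Any two values of one null coordinate occur at two chronologically related points.
\<close>

lemma \<phi>_mono:
  assumes st: "half_plane s t" "half_plane s' t'" "s < s'"
  shows "\<phi> s < \<phi> s'"
proof -
  obtain t1 t2 where *: "t1 < t2" "half_plane s t1" "half_plane s' t2"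
  proof (cases "\<alpha> = 0")
    case True
    then show ?thesis using that[of 0 1] st by (simp add: half_plane_def)
  next
    case False
    then obtain t1 t2 where "t1 < t2" "\<And>x. \<bar>x\<bar> \<le> max \<bar>s\<bar> \<bar>s'\<bar> \<Longrightarrow> \<alpha> * t1 + \<beta> * x > 0"
      "\<And>x. \<bar>x\<bar> \<le> max \<bar>s\<bar> \<bar>s'\<bar> \<Longrightarrow> \<alpha> * t2 + \<beta> * x > 0"
      using common_transversals[OF False, of "max \<bar>s\<bar> \<bar>s'\<bar>" \<beta>] by metis
    then show ?thesis using that[of t1 t2] by (simp add: half_plane_def)
  qed
  show ?thesis
    using isometry_chronological[OF isometry point_in_aff_plus[OF *(2)] point_in_aff_plus[OF *(3)]] st(3) *
    by (simp add: f_point)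
qed

lemma \<psi>_mono:
  assumes st: "half_plane s t" "half_plane s' t'" "t < t'"
  shows "\<psi> t < \<psi> t'"
proof -
  obtain s1 s2 where *: "s1 < s2" "half_plane s1 t" "half_plane s2 t'"
  proof (cases "\<beta> = 0")
    case True
    then show ?thesis using that[of 0 1] st by (simp add: half_plane_def)
  next
    case False
    then obtain s1 s2 where "s1 < s2" "\<And>x. \<bar>x\<bar> \<le> max \<bar>t\<bar> \<bar>t'\<bar> \<Longrightarrow> \<beta> * s1 + \<alpha> * x > 0"
      "\<And>x. \<bar>x\<bar> \<le> max \<bar>t\<bar> \<bar>t'\<bar> \<Longrightarrow> \<beta> * s2 + \<alpha> * x > 0"
      using common_transversals[OF False, of "max \<bar>t\<bar> \<bar>t'\<bar>" \<alpha>] by metis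
    then show ?thesis using that[of s1 s2] by (simp add: half_plane_def add.commute)
  qed
  show ?thesis
    using isometry_chronological[OF isometry point_in_aff_plus[OF *(2)] point_in_aff_plus[OF *(3)]] st(3) *
    by (simp add: f_point)
qed

lemma \<phi>_cont: "half_plane s t \<Longrightarrow> isCont \<phi> s"
proof (rule isCont_strict_mono_onto_open[of "\<Union>t. {s. half_plane s t}"])
  show "\<phi> ` (\<Union>t. {s. half_plane s t}) = (\<Union>t. {s. half_plane s t})"
    using half_plane_image half_plane_onto by blast
qed (use \<phi>_mono open_half_plane in blast)+

lemma \<psi>_cont: "half_plane s t \<Longrightarrow> isCont \<psi> t"
proof (rule isCont_strict_mono_onto_open[of "\<Union>s. {t. half_plane s t}"])
  show "\<psi> ` (\<Union>s. {t. half_plane s t}) = (\<Union>s. {t. half_plane s t})"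
    using half_plane_image half_plane_onto by blast
qed (use \<psi>_mono open_half_plane in blast)+

text \<open>
  Comparing the distance estimates on a small rectangle and on its image shows that the product of
  the difference quotients of \<open>\<phi>\<close> and \<open>\<psi>\<close> converges to the squared ratio of the heights. Hence
  each difference quotient converges.
\<close>

lemma \<phi>_\<psi>_differentiable:
  assumes d0: "half_plane s0 t0"
  shows "\<exists>l m. (\<phi> has_real_derivative l) (at s0) \<and> (\<psi> has_real_derivative m) (at t0) \<and>
      l > 0 \<and> m > 0 \<and> l * m * (\<alpha> * t0 + \<beta> * s0)\<^sup>2 = (\<alpha> * \<psi> t0 + \<beta> * \<phi> s0)\<^sup>2"
proof -
  let ?F = "at s0 \<times>\<^sub>F at t0"
  define y y' where "y = \<alpha> * t0 + \<beta> * s0" and "y' = \<alpha> * \<psi> t0 + \<beta> * \<phi> s0"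
  have y: "y > 0" "y' > 0" using d0 half_plane_image[OF d0] by (auto simp: half_plane_def y_def y'_def)
  define \<Phi> \<Psi> where "\<Phi> s = (\<phi> s - \<phi> s0) / (s - s0)" and "\<Psi> t = (\<psi> t - \<psi> t0) / (t - t0)" for s t
  \<comment> \<open>Oscillation of the height over the rectangle and over its image.\<close>
  define e e' where "e st = \<bar>\<alpha>\<bar> * \<bar>snd st - t0\<bar> + \<bar>\<beta>\<bar> * \<bar>fst st - s0\<bar>"
    and "e' st = \<bar>\<alpha>\<bar> * \<bar>\<psi> (snd st) - \<psi> t0\<bar> + \<bar>\<beta>\<bar> * \<bar>\<phi> (fst st) - \<phi> s0\<bar>" for st
  have lims: "(fst \<longlongrightarrow> s0) ?F" "(snd \<longlongrightarrow> t0) ?F"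
    "((\<lambda>st. \<phi> (fst st)) \<longlongrightarrow> \<phi> s0) ?F" "((\<lambda>st. \<psi> (snd st)) \<longlongrightarrow> \<psi> t0) ?F"
    using filterlim_compose[OF tendsto_ident_at filterlim_fst] filterlim_compose[OF tendsto_ident_at filterlim_snd]
      filterlim_compose[OF _ filterlim_fst] filterlim_compose[OF _ filterlim_snd]
      \<phi>_cont[OF d0] \<psi>_cont[OF d0] unfolding isCont_def by blast+
  have e_lim: "(e \<longlongrightarrow> \<bar>\<alpha>\<bar> * \<bar>t0 - t0\<bar> + \<bar>\<beta>\<bar> * \<bar>s0 - s0\<bar>) ?F"
    unfolding e_def[abs_def] by (intro tendsto_intros lims)
  have e'_lim: "(e' \<longlongrightarrow> \<bar>\<alpha>\<bar> * \<bar>\<psi> t0 - \<psi> t0\<bar> + \<bar>\<beta>\<bar> * \<bar>\<phi> s0 - \<phi> s0\<bar>) ?F"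
    unfolding e'_def[abs_def] by (intro tendsto_intros lims)
  have e_lim0: "(e \<longlongrightarrow> 0) ?F" "(e' \<longlongrightarrow> 0) ?F" using e_lim e'_lim by simp_all
  have ev_s: "\<forall>\<^sub>F s in at s0. half_plane s t0 \<and> s \<noteq> s0"
    using eventually_at_in_open'[OF open_half_plane(1)] d0 eventually_neq_at_within[of s0 s0]
    by (auto intro: eventually_conj)
  have ev_t: "\<forall>\<^sub>F t in at t0. half_plane s0 t \<and> t \<noteq> t0"
    using eventually_at_in_open'[OF open_half_plane(2)] d0 eventually_neq_at_within[of t0 t0]
    by (auto intro: eventually_conj)
  have \<Phi>_pos: "\<Phi> s > 0" if "half_plane s t0" "s \<noteq> s0" for s
    using \<phi>_mono[OF that(1) d0] \<phi>_mono[OF d0 that(1)] that(2)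
    by (auto simp: \<Phi>_def divide_simps linorder_neq_iff)
  have \<Psi>_pos: "\<Psi> t > 0" if "half_plane s0 t" "t \<noteq> t0" for t
    using \<psi>_mono[OF that(1) d0] \<psi>_mono[OF d0 that(1)] that(2)
    by (auto simp: \<Psi>_def divide_simps linorder_neq_iff)
  have ev: "\<forall>\<^sub>F st in ?F. e st < y \<and> e' st < y' \<and>
      (half_plane (fst st) t0 \<and> fst st \<noteq> s0) \<and> (half_plane s0 (snd st) \<and> snd st \<noteq> t0)"
    using order_tendstoD(2)[OF e_lim0(1) y(1)] order_tendstoD(2)[OF e_lim0(2) y(2)]
      eventually_compose_filterlim[OF ev_s filterlim_fst] eventually_compose_filterlim[OF ev_t filterlim_snd]
    by eventually_elim blast
  have bounds: "\<forall>\<^sub>F st in ?F. ((y' - e' st) / (y + e st))\<^sup>2 \<le> \<Phi> (fst st) * \<Psi> (snd st) \<and>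
      \<Phi> (fst st) * \<Psi> (snd st) \<le> ((y' + e' st) / (y - e st))\<^sup>2"
    using ev
  proof eventually_elim
    case (elim st)
    define s t where "s = fst st" and "t = snd st"
    have s: "half_plane s t0" "s \<noteq> s0" and t: "half_plane s0 t" "t \<noteq> t0" and ee: "e st < y" "e' st < y'"
      using elim by (auto simp: s_def t_def)
    have e0: "0 \<le> e st" "0 \<le> e' st" by (auto simp: e_def e'_def)
    have ne: "\<phi> s \<noteq> \<phi> s0" "\<psi> t \<noteq> \<psi> t0" using \<Phi>_pos[OF s] \<Psi>_pos[OF t] by (auto simp: \<Phi>_def \<Psi>_def)
    have st: "half_plane (min s s0) (min t t0)" "half_plane (max s s0) (max t t0)"
      using lorentz_dist_rectangle(1,2)[OF s(2) t(2) refl y_def] ee by (simp_all add: e_def s_def t_def half_plane_iff)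
    have "\<phi> (min s s0) = min (\<phi> s) (\<phi> s0)" "\<phi> (max s s0) = max (\<phi> s) (\<phi> s0)"
      using \<phi>_mono[OF s(1) d0] \<phi>_mono[OF d0 s(1)] by (auto simp: min_def max_def le_less)
    moreover have "\<psi> (min t t0) = min (\<psi> t) (\<psi> t0)" "\<psi> (max t t0) = max (\<psi> t) (\<psi> t0)"
      using \<psi>_mono[OF t(1) d0] \<psi>_mono[OF d0 t(1)] by (auto simp: min_def max_def le_less)
    ultimately have d_eq: "lorentz_dist A (point (min (\<phi> s) (\<phi> s0)) (min (\<psi> t) (\<psi> t0)))
         (point (max (\<phi> s) (\<phi> s0)) (max (\<psi> t) (\<psi> t0))) =
        lorentz_dist A (point (min s s0) (min t t0)) (point (max s s0) (max t t0))"
      using isometryD(2)[OF isometry point_in_aff_plus[OF st(1)] point_in_aff_plus[OF st(2)]] by (simp add: f_point st)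
    define r r' where "r = sqrt (\<bar>s - s0\<bar> * \<bar>t - t0\<bar>)" and "r' = sqrt (\<bar>\<phi> s - \<phi> s0\<bar> * \<bar>\<psi> t - \<psi> t0\<bar>)"
    have r: "r > 0" using s t by (simp add: r_def)
    have r'0: "r' \<ge> 0" by (simp add: r'_def)
    note B = lorentz_dist_rectangle(3,4)[OF s(2) t(2) refl y_def]
    note B' = lorentz_dist_rectangle(3,4)[OF ne refl y'_def]
    have est: "\<bar>\<alpha>\<bar> * \<bar>t - t0\<bar> + \<bar>\<beta>\<bar> * \<bar>s - s0\<bar> = e st"
      "\<bar>\<alpha>\<bar> * \<bar>\<psi> t - \<psi> t0\<bar> + \<bar>\<beta>\<bar> * \<bar>\<phi> s - \<phi> s0\<bar> = e' st" by (simp_all add: e_def e'_def s_def t_def)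
    have "ennreal (r' / (y' + e' st)) \<le> ennreal (r / (y - e st))"
      using order_trans[OF B'(1) B(2)[folded d_eq]] ee unfolding est r_def r'_def by simp
    then have 1: "r' / (y' + e' st) \<le> r / (y - e st)" using ee r by (subst (asm) ennreal_le_iff) auto
    have "ennreal (r / (y + e st)) \<le> ennreal (r' / (y' - e' st))"
      using order_trans[OF B(1)[folded d_eq] B'(2)] ee unfolding est r_def r'_def by simp
    then have 2: "r / (y + e st) \<le> r' / (y' - e' st)" using ee r'0 by (subst (asm) ennreal_le_iff) auto
    have ratio: "\<Phi> s * \<Psi> t = (r' / r)\<^sup>2"
    proof -
      have "\<Phi> s * \<Psi> t = \<bar>\<Phi> s\<bar> * \<bar>\<Psi> t\<bar>" using \<Phi>_pos[OF s] \<Psi>_pos[OF t] by simp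
      also have "\<dots> = (r' / r)\<^sup>2" by (simp add: \<Phi>_def \<Psi>_def r_def r'_def power_divide abs_divide)
      finally show ?thesis .
    qed
    have up: "r' / r \<le> (y' + e' st) / (y - e st)"
      using 1 r ee e0 y by (simp add: field_simps)
    have low: "(y' - e' st) / (y + e st) \<le> r' / r"
      using 2 r ee e0 y by (simp add: field_simps)
    show "((y' - e' st) / (y + e st))\<^sup>2 \<le> \<Phi> (fst st) * \<Psi> (snd st) \<and>
      \<Phi> (fst st) * \<Psi> (snd st) \<le> ((y' + e' st) / (y - e st))\<^sup>2"
      unfolding s_def[symmetric] t_def[symmetric] ratio
      using up low ee e0 y r r'0 by (intro conjI power_mono) auto
  qed
  have "((\<lambda>st. \<Phi> (fst st) * \<Psi> (snd st)) \<longlongrightarrow> (y' / y)\<^sup>2) ?F"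
  proof (rule real_tendsto_sandwich)
    show "\<forall>\<^sub>F st in ?F. ((y' - e' st) / (y + e st))\<^sup>2 \<le> \<Phi> (fst st) * \<Psi> (snd st)"
      "\<forall>\<^sub>F st in ?F. \<Phi> (fst st) * \<Psi> (snd st) \<le> ((y' + e' st) / (y - e st))\<^sup>2"
      using bounds by (auto elim: eventually_mono)
    have "((\<lambda>st. ((y' - e' st) / (y + e st))\<^sup>2) \<longlongrightarrow> ((y' - 0) / (y + 0))\<^sup>2) ?F"
      using y by (intro tendsto_intros e_lim0) auto
    then show "((\<lambda>st. ((y' - e' st) / (y + e st))\<^sup>2) \<longlongrightarrow> (y' / y)\<^sup>2) ?F" by simp
    have "((\<lambda>st. ((y' + e' st) / (y - e st))\<^sup>2) \<longlongrightarrow> ((y' + 0) / (y - 0))\<^sup>2) ?F"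
      using y by (intro tendsto_intros e_lim0) auto
    then show "((\<lambda>st. ((y' + e' st) / (y - e st))\<^sup>2) \<longlongrightarrow> (y' / y)\<^sup>2) ?F" by simp
  qed
  then have "((\<lambda>(s, t). \<Phi> s * \<Psi> t) \<longlongrightarrow> (y' / y)\<^sup>2) ?F" by (simp add: case_prod_unfold)
  then obtain l m where l: "(\<Phi> \<longlongrightarrow> l) (at s0)" and m: "(\<Psi> \<longlongrightarrow> m) (at t0)" and lm: "l * m = (y' / y)\<^sup>2"
    by (rule tendsto_factors_of_product) (use y in auto)
  have "l \<ge> 0"
    by (rule tendsto_lowerbound[OF l]) (use ev_s \<Phi>_pos in \<open>auto elim!: eventually_mono intro: less_imp_le\<close>)
  moreover have "m \<ge> 0"
    by (rule tendsto_lowerbound[OF m]) (use ev_t \<Psi>_pos in \<open>auto elim!: eventually_mono intro: less_imp_le\<close>)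
  moreover have "l * m > 0" using lm y by simp
  ultimately have "l > 0" "m > 0" by (auto simp: zero_less_mult_iff)
  moreover have "l * m * y\<^sup>2 = y'\<^sup>2" using lm y by (simp add: power_divide)
  ultimately show ?thesis using l m
    unfolding has_field_derivative_iff \<Phi>_def[abs_def] \<Psi>_def[abs_def] y_def y'_def by blast
qed

text \<open>
  The derivatives satisfy the equation of an isometry of the metric, so the map is a homothety
  of the plane combined with a translation along the boundary, that is, a left translation.
\<close>

theorem f_left_translation: "f \<in> left_translation ` aff_plus"
proof -
  have D: "(\<phi> has_real_derivative deriv \<phi> s) (at s) \<and> (\<psi> has_real_derivative deriv \<psi> t) (at t) \<and>
      deriv \<phi> s > 0 \<and> deriv \<psi> t > 0 \<and>
      deriv \<phi> s * deriv \<psi> t * (\<alpha> * t + \<beta> * s)\<^sup>2 = (\<alpha> * \<psi> t + \<beta> * \<phi> s)\<^sup>2"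
    if "half_plane s t" for s t
    using \<phi>_\<psi>_differentiable[OF that] by (metis DERIV_imp_deriv)
  obtain c \<mu> \<nu> where c: "c > 0" "\<alpha> * \<nu> + \<beta> * \<mu> = 0"
    and affine: "\<And>s t. half_plane s t \<Longrightarrow> \<phi> s = c * s + \<mu> \<and> \<psi> t = c * t + \<nu>"
  proof (rule conformal_factor_preserving_is_homothety[of \<alpha> \<beta> \<psi> \<phi> "deriv \<phi>" "deriv \<psi>", folded half_plane_def])
    show "\<alpha> \<noteq> 0 \<or> \<beta> \<noteq> 0" by (rule \<alpha>_\<beta>_nonzero)
    show "half_plane (\<phi> s) (\<psi> t)" if "half_plane s t" for s t using half_plane_image[OF that] .
    show "\<phi> s < \<phi> s'" if "half_plane s t" "half_plane s' t'" "s < s'" for s t s' t' using \<phi>_mono[OF that] .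
    show "\<psi> t < \<psi> t'" if "half_plane s t" "half_plane s' t'" "t < t'" for s t s' t' using \<psi>_mono[OF that] .
    show "\<exists>s' t'. half_plane s' t' \<and> \<phi> s' = s \<and> \<psi> t' = t" if "half_plane s t" for s t
      using half_plane_onto[OF that] .
  qed (use D in blast)+
  define q where "q = (fst (point \<mu> \<nu>), c)"
  have q: "q \<in> aff_plus" using c by (simp add: q_def aff_plus_def)
  have "f p = left_translation q p" for p
  proof (cases "p \<in> aff_plus")
    case True
    have "f p = aff_mult q p"
    proof (rule null_coords_inject)
      have "(fst (point \<mu> \<nu>), 0) = point \<mu> \<nu>" using c by (simp add: prod_eq_iff)
      then have "aff_mult q p = point \<mu> \<nu> + c *\<^sub>R p" by (simp add: aff_mult_eq q_def)
      then show "\<xi> (f p) = \<xi> (aff_mult q p)" "\<eta> (f p) = \<eta> (aff_mult q p)"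
        using prod[OF True] affine[of "\<xi> p" "\<eta> p"] True by (auto simp: in_aff_plus_iff)
    qed
    then show ?thesis using True by (simp add: left_translation_def)
  next
    case False
    then show ?thesis using extensional_arb[OF isometryD(5)[OF isometry]] by (simp add: left_translation_def)
  qed
  then show ?thesis using q by (auto simp: fun_eq_iff image_iff)
qed

end

section \<open>The identity component of the isometry group\<close>

lemma aff_mult_assoc: "aff_mult (aff_mult q p) r = aff_mult q (aff_mult p r)"
  by (simp add: aff_mult_def algebra_simps)

lemma connected_aff_plus: "connected aff_plus"
proof -
  have "aff_plus = {p. inner (0, 1) p > (0::real)}" by (auto simp: aff_plus_def inner_prod_def)
  then show ?thesis by (metis convex_connected convex_halfspace_gt)
qed

context left_invariant_lorentzian
begin

text \<open>
  The subbasic open sets of the compact-open topology pull back to open sets by the tube lemma.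
\<close>

lemma continuous_map_left_translation:
  "continuous_map (top_of_set aff_plus) (isometry_topology A) left_translation"
  unfolding isometry_topology_def continuous_map_in_subtopology
proof
  show "left_translation \<in> topspace (top_of_set aff_plus) \<rightarrow> isometries A"
    using left_translation_isometry by auto
  show "continuous_map (top_of_set aff_plus)
     (topology_generated_by {{f. f ` K \<subseteq> U} | K U. compact K \<and> K \<subseteq> aff_plus \<and> open U}) left_translation"
    unfolding continuous_on_generated_topo_iff
  proof (intro conjI allI impI)
    fix W :: "(real \<times> real \<Rightarrow> real \<times> real) set"
    assume "W \<in> {{f. f ` K \<subseteq> U} | K U. compact K \<and> K \<subseteq> aff_plus \<and> open U}"
    then obtain K U where W: "W = {f. f ` K \<subseteq> U}" and K: "compact K" "K \<subseteq> aff_plus" and U: "open U" by blast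
    define V where "V = {q. \<forall>p\<in>K. aff_mult q p \<in> U}"
    have cont: "continuous_on UNIV (\<lambda>(q, p). aff_mult q p)"
      unfolding aff_mult_def case_prod_unfold by (intro continuous_intros)
    have "open V"
    proof (rule Topological_Spaces.openI)
      fix q assume q: "q \<in> V"
      have 1: "open ((\<lambda>(q, p). aff_mult q p) -` U)" using open_vimage[OF U cont] .
      have 2: "{q} \<times> K \<subseteq> (\<lambda>(q, p). aff_mult q p) -` U" using q by (auto simp: V_def)
      obtain X where X: "q \<in> X" "open X" "X \<times> K \<subseteq> (\<lambda>(q, p). aff_mult q p) -` U"
        using Elementary_Topology.tube_lemma[OF K(1) 1 2] by metis
      have "X \<subseteq> V"
      proof
        fix x assume "x \<in> X"
        then show "x \<in> V" using X(3) by (force simp: V_def simp del: split_paired_All)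
      qed
      then show "\<exists>X. open X \<and> q \<in> X \<and> X \<subseteq> V" using X by metis
    qed
    moreover have "left_translation -` W \<inter> topspace (top_of_set aff_plus) = aff_plus \<inter> V"
      using K(2) by (auto simp: W V_def left_translation_def)
    ultimately show "openin (top_of_set aff_plus) (left_translation -` W \<inter> topspace (top_of_set aff_plus))"
      by (simp add: openin_open_Int)
  next
    have "(UNIV :: (real \<times> real \<Rightarrow> real \<times> real) set) \<in>
        {{f. f ` K \<subseteq> U} | K U. compact K \<and> K \<subseteq> aff_plus \<and> open U}"
      by (rule CollectI, rule exI[of _ "{}"]) auto
    then show "left_translation ` topspace (top_of_set aff_plus) \<subseteq>
        \<Union> {{f. f ` K \<subseteq> U} | K U. compact K \<and> K \<subseteq> aff_plus \<and> open U}" by blast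
  qed
qed

lemma left_translation_unit: "left_translation (0, 1) = (\<lambda>p\<in>aff_plus. p)"
  by (simp add: left_translation_def aff_mult_def)

lemma left_translation_at_unit: "left_translation q (0, 1) = q"
  by (simp add: left_translation_def aff_mult_def aff_plus_def)

text \<open>
  The group is connected, so left translations by its elements lie in the identity component.
  Conversely, elements of the component are product maps in null coordinates.
\<close>

theorem isometries0_eq: "isometries0 A = left_translation ` aff_plus"
proof
  show "left_translation ` aff_plus \<subseteq> isometries0 A"
    unfolding isometries0_def one_isometry_group
  proof (rule connected_component_of_maximal)
    have "connectedin (top_of_set aff_plus) aff_plus"
      using connected_aff_plus by (simp add: connectedin_subtopology)
    then show "connectedin (isometry_topology A) (left_translation ` aff_plus)"
      by (rule connectedin_continuous_map_image[OF continuous_map_left_translation])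
    have "(0, 1) \<in> aff_plus" by (simp add: aff_plus_def)
    then show "(\<lambda>p\<in>aff_plus. p) \<in> left_translation ` aff_plus"
      using left_translation_unit by (metis imageI)
  qed
  show "isometries0 A \<subseteq> left_translation ` aff_plus"
  proof
    fix f assume f0: "f \<in> isometries0 A"
    then have f: "f \<in> isometries A"
      using connected_component_of_subset_topspace[of "isometry_topology A"] unfolding isometries0_def by auto
    define \<phi> where "\<phi> s = \<xi> (f (SOME p. p \<in> aff_plus \<and> \<xi> p = s))" for s
    define \<psi> where "\<psi> t = \<eta> (f (SOME p. p \<in> aff_plus \<and> \<eta> p = t))" for t
    have "product_isometry A f \<phi> \<psi>"
    proof (unfold_locales, rule f)
      fix p assume p: "p \<in> aff_plus"
      have r: "(SOME r. r \<in> aff_plus \<and> \<xi> r = \<xi> p) \<in> aff_plus \<and> \<xi> (SOME r. r \<in> aff_plus \<and> \<xi> r = \<xi> p) = \<xi> p"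
        by (rule someI[of _ p]) (simp add: p)
      have r': "(SOME r. r \<in> aff_plus \<and> \<eta> r = \<eta> p) \<in> aff_plus \<and> \<eta> (SOME r. r \<in> aff_plus \<and> \<eta> r = \<eta> p) = \<eta> p"
        by (rule someI[of _ p]) (simp add: p)
      show "\<xi> (f p) = \<phi> (\<xi> p) \<and> \<eta> (f p) = \<psi> (\<eta> p)"
        unfolding \<phi>_def \<psi>_def
        using isometries0_preserve_null_coords(1)[OF f0 p conjunct1[OF r] conjunct2[OF r, symmetric]]
          isometries0_preserve_null_coords(2)[OF f0 p conjunct1[OF r'] conjunct2[OF r', symmetric]] by (rule conjI)
    qed
    then show "f \<in> left_translation ` aff_plus" by (rule product_isometry.f_left_translation)
  qed
qed

text \<open>
  Evaluation at the unit element is the continuous inverse.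
\<close>

theorem left_translation_lie_group_iso:
  "lie_group_iso aff_group (top_of_set aff_plus)
      (isometry_group0 A) (subtopology (isometry_topology A) (isometries0 A)) left_translation"
  unfolding lie_group_iso_def
proof
  have "left_translation (aff_mult q p) = compose aff_plus (left_translation q) (left_translation p)"
    if "q \<in> aff_plus" "p \<in> aff_plus" for q p
  proof
    fix r
    show "left_translation (aff_mult q p) r = compose aff_plus (left_translation q) (left_translation p) r"
      using that aff_mult_in_aff_plus[OF that(2), of r]
      by (cases "r \<in> aff_plus") (simp_all add: left_translation_def compose_def aff_mult_assoc)
  qed
  moreover have "inj_on left_translation aff_plus"
    by (rule inj_on_inverseI[where g = "\<lambda>f. f (0, 1)"]) (rule left_translation_at_unit)
  ultimately show "left_translation \<in> iso aff_group (isometry_group0 A)"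
    using left_translation_Bij
    by (auto simp: iso_def hom_def bij_betw_def aff_group_def isometry_group0_def isometry_group_def
        BijGroup_def isometries0_eq)
  have "homeomorphic_maps (top_of_set aff_plus) (subtopology (isometry_topology A) (isometries0 A))
      left_translation (\<lambda>f. f (0, 1))"
    unfolding homeomorphic_maps_def
  proof (intro conjI ballI)
    show "continuous_map (top_of_set aff_plus) (subtopology (isometry_topology A) (isometries0 A)) left_translation"
      by (auto simp: continuous_map_in_subtopology continuous_map_left_translation isometries0_eq)
    have "(0, 1) \<in> aff_plus" by (simp add: aff_plus_def)
    then show "continuous_map (subtopology (isometry_topology A) (isometries0 A)) (top_of_set aff_plus) (\<lambda>f. f (0, 1))"
      by (auto simp: continuous_map_in_subtopology isometries0_eq left_translation_at_unit
          intro: continuous_map_from_subtopology continuous_map_evaluation)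
  qed (auto simp: left_translation_at_unit isometries0_eq)
  then show "homeomorphic_map (top_of_set aff_plus)
      (subtopology (isometry_topology A) (isometries0 A)) left_translation"
    using homeomorphic_map_maps by blast
qed

end

section \<open>Complete Killing fields\<close>

lemma open_aff_plus: "open aff_plus"
  unfolding aff_plus_def by (intro open_Collect_less continuous_intros)

lemma Ck_on_const: "Ck_on k S (\<lambda>_. c)"
  by (induction k arbitrary: c) (simp_all add: frechet_derivative_const)

lemma Ck_on_cong:
  assumes S: "open S" and eq: "\<And>x. x \<in> S \<Longrightarrow> f x = g x" and f: "Ck_on k S f"
  shows "Ck_on k S g"
  using eq f
proof (induction k arbitrary: f g)
  case 0
  then show ?case by (simp cong: continuous_on_cong)
next
  case (Suc k)
  have g: "(g has_derivative frechet_derivative f (at x)) (at x)" if "x \<in> S" for x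
  proof (rule has_derivative_transform_within_open[OF _ S that])
    show "(f has_derivative frechet_derivative f (at x)) (at x)"
      using Suc.prems(2) that by (simp add: frechet_derivative_works[symmetric])
  qed (rule Suc.prems(1))
  show ?case unfolding Ck_on.simps
  proof (intro conjI ballI allI)
    show "g differentiable at x" if "x \<in> S" for x using g[OF that] by (rule differentiableI)
    show "Ck_on k S (\<lambda>x. frechet_derivative g (at x) v)" for v
    proof (rule Suc.IH)
      show "Ck_on k S (\<lambda>x. frechet_derivative f (at x) v)" using Suc.prems by simp
      show "frechet_derivative f (at x) v = frechet_derivative g (at x) v" if "x \<in> S" for x
        using frechet_derivative_at[OF g[OF that]] by simp
    qed
  qed
qed

lemma half_plane_unbounded:
  fixes \<alpha> \<beta> :: real
  assumes "\<alpha> \<noteq> 0 \<or> \<beta> \<noteq> 0"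
  obtains s t where "\<alpha> * t + \<beta> * s > 0" "R < \<bar>s\<bar>"
proof (cases "\<alpha> = 0")
  case True
  have "\<beta> * (sgn \<beta> * (\<bar>R\<bar> + 1)) = \<bar>\<beta>\<bar> * (\<bar>R\<bar> + 1)" by (simp add: abs_sgn)
  also have "\<dots> > 0" using True assms by simp
  finally show ?thesis using that[of 0 "sgn \<beta> * (\<bar>R\<bar> + 1)"] True assms by (simp add: abs_mult abs_sgn_eq)
next
  case False
  then obtain t where "\<alpha> * t + \<beta> * (\<bar>R\<bar> + 1) > 0"
    using common_transversals[OF False, of "\<bar>\<bar>R\<bar> + 1\<bar>" \<beta>] by (metis order_refl)
  then show ?thesis using that[of t "\<bar>R\<bar> + 1"] by simp
qed

context left_invariant_lorentzian
begin

text \<open>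
  The flat metric \<open>2 d\<xi> d\<eta>\<close>; the metric of the group is \<open>- null_form / (2 * y\<^sup>2)\<close>.
\<close>

definition null_form :: "real \<times> real \<Rightarrow> real \<times> real \<Rightarrow> real" where
  "null_form v w = \<xi> v * \<eta> w + \<eta> v * \<xi> w"

text \<open>
  The derivatives of the two test fields cancel, as they must for a tensor.
\<close>

lemma lie_derivative_metric_eq:
  assumes q: "q \<in> aff_plus"
    and X: "(X has_derivative DX) (at q)" and V: "(V has_derivative DV) (at q)" and W: "(W has_derivative DW) (at q)"
  shows "lie_derivative_metric A X V W q =
    (2 * (snd (X q) / snd q) * null_form (V q) (W q) - null_form (DX (V q)) (W q) - null_form (V q) (DX (W q)))
      / (2 * (snd q)\<^sup>2)"
proof -
  have y: "snd q > 0" using q by (simp add: aff_plus_def)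
  have D: "((\<lambda>p. metric A p (V p) (W p)) has_derivative (\<lambda>h.
      - (null_form (DV h) (W q) + null_form (V q) (DW h)) / (2 * (snd q)\<^sup>2)
      + null_form (V q) (W q) * snd h / (snd q) ^ 3)) (at q)"
  proof -
    note xV = bounded_linear.has_derivative[OF bounded_linear_\<xi> V]
    note eV = bounded_linear.has_derivative[OF bounded_linear_\<eta> V]
    note xW = bounded_linear.has_derivative[OF bounded_linear_\<xi> W]
    note eW = bounded_linear.has_derivative[OF bounded_linear_\<eta> W]
    show ?thesis
      unfolding metric_eq
      by (rule has_derivative_eq_rhs, rule has_derivative_divide,
          rule has_derivative_minus, rule has_derivative_add, rule has_derivative_mult[OF xV eW],
          rule has_derivative_mult[OF eV xW], rule has_derivative_mult_right, rule has_derivative_power,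
          rule has_derivative_snd, rule has_derivative_ident)
        (use y in \<open>auto simp: null_form_def fun_eq_iff field_simps power2_eq_square power3_eq_cube\<close>)
  qed
  have metric_null: "metric A q v w = - null_form v w / (2 * (snd q)\<^sup>2)" for v w
    by (simp add: metric_eq null_form_def)
  have bracket: "lie_bracket X V q = DV (X q) - DX (V q)" "lie_bracket X W q = DW (X q) - DX (W q)"
    by (simp_all add: lie_bracket_def frechet_derivative_at[OF X, symmetric]
        frechet_derivative_at[OF V, symmetric] frechet_derivative_at[OF W, symmetric])
  have sub: "null_form (v - v') w = null_form v w - null_form v' w"
    "null_form v (w - w') = null_form v w - null_form v w'" for v v' w w'
    by (simp_all add: null_form_def algebra_simps)
  show ?thesis
    unfolding lie_derivative_metric_def frechet_derivative_at[OF D, symmetric] bracket metric_null sub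
    using y by (simp add: field_simps power2_eq_square power3_eq_cube)
qed

text \<open>
  The field is affine, and its linear part is the scaling by \<open>b\<close>, which matches the logarithmic
  derivative \<open>b\<close> of \<open>y\<close> along the field. Its flow is given by translations and dilations.
\<close>

lemma right_invariant_field_complete_killing:
  "(\<lambda>q\<in>aff_plus. a *\<^sub>R right_field1 q + b *\<^sub>R right_field2 q) \<in> complete_killing_fields A"
proof -
  define X where "X = (\<lambda>q\<in>aff_plus. a *\<^sub>R right_field1 q + b *\<^sub>R right_field2 q)"
  have X_eq: "X q = (a, 0) + b *\<^sub>R q" if "q \<in> aff_plus" for q
    using that by (simp add: X_def right_field1_def right_field2_def prod_eq_iff)
  have X_deriv: "(X has_derivative (\<lambda>v. b *\<^sub>R v)) (at q)" if "q \<in> aff_plus" for q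
  proof (rule has_derivative_transform_within_open[OF _ open_aff_plus that])
    show "((\<lambda>q. (a, 0) + b *\<^sub>R q) has_derivative (\<lambda>v. b *\<^sub>R v)) (at q)"
      by (auto intro!: derivative_eq_intros)
  qed (simp add: X_eq)
  have "Ck_on k aff_plus X" for k
  proof (cases k)
    case 0
    then show ?thesis
      using X_deriv by (auto intro!: continuous_at_imp_continuous_on has_derivative_continuous)
  next
    case (Suc j)
    have "Ck_on j aff_plus (\<lambda>x. frechet_derivative X (at x) v)" for v
      by (rule Ck_on_cong[OF open_aff_plus _ Ck_on_const[of j aff_plus "b *\<^sub>R v"]])
        (simp add: frechet_derivative_at[OF X_deriv, symmetric])
    then show ?thesis using Suc differentiableI[OF X_deriv] by simp
  qed
  moreover have "lie_derivative_metric A X V W q = 0"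
    if "smooth_on aff_plus V" "smooth_on aff_plus W" "q \<in> aff_plus" for V W q
  proof -
    have "Ck_on (Suc 0) aff_plus V" "Ck_on (Suc 0) aff_plus W" using that unfolding smooth_on_def by blast+
    then have "(V has_derivative frechet_derivative V (at q)) (at q)"
      "(W has_derivative frechet_derivative W (at q)) (at q)"
      using that(3) by (auto simp: frechet_derivative_works)
    from lie_derivative_metric_eq[OF that(3) X_deriv[OF that(3)] this]
    show ?thesis using that(3) by (simp add: X_eq aff_plus_def null_form_def algebra_simps)
  qed
  moreover have "complete_field X"
    unfolding complete_field_def
  proof
    fix q assume q: "q \<in> aff_plus"
    show "\<exists>\<gamma>::real \<Rightarrow> real \<times> real. \<gamma> 0 = q \<and>
      (\<forall>t. \<gamma> t \<in> aff_plus \<and> (\<gamma> has_vector_derivative X (\<gamma> t)) (at t))"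
    proof (cases "b = 0")
      case True
      define \<gamma> where "\<gamma> t = q + t *\<^sub>R (a, 0)" for t :: real
      have "\<gamma> t \<in> aff_plus" for t using q by (simp add: \<gamma>_def aff_plus_def)
      moreover have "(\<gamma> has_vector_derivative (a, 0)) (at t)" for t
        unfolding \<gamma>_def by (auto intro!: derivative_eq_intros)
      moreover have "\<gamma> 0 = q" by (simp add: \<gamma>_def prod_eq_iff)
      ultimately show ?thesis using True by (intro exI[of _ \<gamma>]) (simp add: X_eq)
    next
      case False
      define \<gamma> where "\<gamma> t = exp (b * t) *\<^sub>R (q + (a / b, 0)) - (a / b, 0)" for t :: real
      have "\<gamma> t \<in> aff_plus" for t using q by (simp add: \<gamma>_def aff_plus_def)
      moreover have "(\<gamma> has_vector_derivative (b * exp (b * t)) *\<^sub>R (q + (a / b, 0))) (at t)" for t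
      proof -
        have "((\<lambda>t. exp (b * t)) has_real_derivative b * exp (b * t)) (at t)"
          by (auto intro!: derivative_eq_intros)
        from has_vector_derivative_diff[OF
            has_vector_derivative_scaleR[OF this has_vector_derivative_const] has_vector_derivative_const]
        show ?thesis by (simp add: \<gamma>_def[abs_def])
      qed
      moreover have "(b * exp (b * t)) *\<^sub>R (q + (a / b, 0)) = (a, 0) + b *\<^sub>R \<gamma> t" for t
        using False by (simp add: \<gamma>_def prod_eq_iff algebra_simps)
      moreover have "\<gamma> 0 = q" by (simp add: \<gamma>_def)
      ultimately show ?thesis by (intro exI[of _ \<gamma>]) (simp add: X_eq)
    qed
  qed
  ultimately show ?thesis
    unfolding X_def[symmetric] complete_killing_fields_def killing_field_def smooth_on_def
    by (auto simp: X_def)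
qed

text \<open>
  The Killing equation evaluated on the constant null fields \<open>point 1 0\<close> and \<open>point 0 1\<close>: the first two
  equations are those of a conformal field, the third one involves the conformal factor.
\<close>

lemma killing_field_null_equations:
  assumes K: "killing_field A X" and q: "q \<in> aff_plus"
  obtains DX where "(X has_derivative DX) (at q)" "\<eta> (DX (point 1 0)) = 0" "\<xi> (DX (point 0 1)) = 0"
    "(\<xi> (DX (point 1 0)) + \<eta> (DX (point 0 1))) * snd q = 2 * snd (X q)"
proof -
  have "Ck_on (Suc 0) aff_plus X" using K unfolding killing_field_def smooth_on_def by blast
  then obtain DX where DX: "(X has_derivative DX) (at q)"
    using q by (auto simp: differentiable_def)
  have y: "snd q > 0" using q by (simp add: aff_plus_def)
  have eq: "null_form (DX v) w + null_form v (DX w) = 2 * (snd (X q) / snd q) * null_form v w" for v w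
  proof -
    have "lie_derivative_metric A X (\<lambda>_. v) (\<lambda>_. w) q = 0"
      using K q by (simp add: killing_field_def smooth_on_def Ck_on_const)
    then show ?thesis
      unfolding lie_derivative_metric_eq[OF q DX has_derivative_const has_derivative_const] using y by simp
  qed
  show ?thesis
  proof (rule that[OF DX])
    show "\<eta> (DX (point 1 0)) = 0" using eq[of "point 1 0" "point 1 0"] by (simp add: null_form_def)
    show "\<xi> (DX (point 0 1)) = 0" using eq[of "point 0 1" "point 0 1"] by (simp add: null_form_def)
    show "(\<xi> (DX (point 1 0)) + \<eta> (DX (point 0 1))) * snd q = 2 * snd (X q)"
      using eq[of "point 1 0" "point 0 1"] y by (simp add: null_form_def)
  qed
qed

lemma has_vector_derivative_point:
  "((\<lambda>s. point s t) has_vector_derivative point 1 0) (at s)"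
  "((\<lambda>t. point s t) has_vector_derivative point 0 1) (at t)"
proof -
  have 1: "(\<lambda>s. point s t) = (\<lambda>s. point 0 t + s *\<^sub>R point 1 0)"
    by (rule ext, rule null_coords_inject) simp_all
  show "((\<lambda>s. point s t) has_vector_derivative point 1 0) (at s)"
    unfolding 1 by (auto intro!: derivative_eq_intros)
  have 2: "(\<lambda>t. point s t) = (\<lambda>t. point s 0 + t *\<^sub>R point 0 1)"
    by (rule ext, rule null_coords_inject) simp_all
  show "((\<lambda>t. point s t) has_vector_derivative point 0 1) (at t)"
    by (subst 2) (auto intro!: derivative_eq_intros)
qed

text \<open>
  By the conformal equations each null component of the field depends on one null coordinate only,
  since the half-plane meets every null line in a connected set.
\<close>

lemma killing_field_separates:
  assumes K: "killing_field A X"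
  obtains f g where
    "\<And>p. p \<in> aff_plus \<Longrightarrow> \<xi> (X p) = f (\<xi> p) \<and> \<eta> (X p) = g (\<eta> p)"
    "\<And>s t. \<alpha> * t + \<beta> * s > 0 \<Longrightarrow> (f has_real_derivative deriv f s) (at s)"
    "\<And>s t. \<alpha> * t + \<beta> * s > 0 \<Longrightarrow> (g has_real_derivative deriv g t) (at t)"
    "\<And>s t. \<alpha> * t + \<beta> * s > 0 \<Longrightarrow>
      (deriv f s + deriv g t) * (\<alpha> * t + \<beta> * s) = 2 * (\<beta> * f s + \<alpha> * g t)"
proof -
  have half_plane_convex: "convex {s. half_plane s t}" "convex {t. half_plane s t}" for s t
  proof -
    have "{s. half_plane s t} = {s. inner \<beta> s > - \<alpha> * t}" "{t. half_plane s t} = {t. inner \<alpha> t > - \<beta> * s}"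
      by (auto simp: half_plane_def inner_real_def)
    then show "convex {s. half_plane s t}" "convex {t. half_plane s t}" by (simp_all only: convex_halfspace_gt)
  qed
  have along: "((\<lambda>s. L (X (point s t))) has_real_derivative L (DX (point 1 0))) (at s)"
    "((\<lambda>t. L (X (point s t))) has_real_derivative L (DX (point 0 1))) (at t)"
    if "bounded_linear L" "(X has_derivative DX) (at (point s t))" for L DX s t
  proof -
    have 1: "((\<lambda>s. X (point s t)) has_vector_derivative DX (point 1 0)) (at s)"
      using vector_derivative_diff_chain_within[OF has_vector_derivative_point(1) has_derivative_at_withinI[OF that(2)]]
      by (simp add: o_def)
    have 2: "((\<lambda>t. X (point s t)) has_vector_derivative DX (point 0 1)) (at t)"
      using vector_derivative_diff_chain_within[OF has_vector_derivative_point(2) has_derivative_at_withinI[OF that(2)]]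
      by (simp add: o_def)
    show "((\<lambda>s. L (X (point s t))) has_real_derivative L (DX (point 1 0))) (at s)"
      "((\<lambda>t. L (X (point s t))) has_real_derivative L (DX (point 0 1))) (at t)"
      using bounded_linear.has_vector_derivative[OF that(1) 1] bounded_linear.has_vector_derivative[OF that(1) 2]
      by (simp_all add: has_real_derivative_iff_has_vector_derivative)
  qed
  have const: "\<xi> (X (point s t)) = \<xi> (X (point s t'))" if "half_plane s t" "half_plane s t'" for s t t'
  proof -
    have "\<exists>c. \<forall>t\<in>{t. half_plane s t}. \<xi> (X (point s t)) = c"
    proof (rule has_field_derivative_zero_constant[OF half_plane_convex(2)])
      fix t assume "t \<in> {t. half_plane s t}"
      then have "point s t \<in> aff_plus" by (simp add: half_plane_def)
      from killing_field_null_equations[OF K this] show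
        "((\<lambda>t. \<xi> (X (point s t))) has_real_derivative 0) (at t within {t. half_plane s t})"
        by (metis along(2)[OF bounded_linear_\<xi>] has_field_derivative_at_within)
    qed
    then show ?thesis using that by force
  qed
  have const': "\<eta> (X (point s t)) = \<eta> (X (point s' t))" if "half_plane s t" "half_plane s' t" for s s' t
  proof -
    have "\<exists>c. \<forall>s\<in>{s. half_plane s t}. \<eta> (X (point s t)) = c"
    proof (rule has_field_derivative_zero_constant[OF half_plane_convex(1)])
      fix s assume "s \<in> {s. half_plane s t}"
      then have "point s t \<in> aff_plus" by (simp add: half_plane_def)
      from killing_field_null_equations[OF K this] show
        "((\<lambda>s. \<eta> (X (point s t))) has_real_derivative 0) (at s within {s. half_plane s t})"
        by (metis along(1)[OF bounded_linear_\<eta>] has_field_derivative_at_within)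
    qed
    then show ?thesis using that by force
  qed
  define f g where "f s = \<xi> (X (point s (SOME t. half_plane s t)))" and "g t = \<eta> (X (point (SOME s. half_plane s t) t))" for s t
  have f: "f s = \<xi> (X (point s t))" if "half_plane s t" for s t
    unfolding f_def by (rule const[OF someI[of "half_plane s", OF that] that])
  have g: "g t = \<eta> (X (point s t))" if "half_plane s t" for s t
    unfolding g_def by (rule const'[OF someI[of "\<lambda>s. half_plane s t", OF that] that])
  have D: "(f has_real_derivative deriv f s) (at s) \<and> (g has_real_derivative deriv g t) (at t) \<and>
      (deriv f s + deriv g t) * (\<alpha> * t + \<beta> * s) = 2 * (\<beta> * f s + \<alpha> * g t)" if st: "half_plane s t" for s t
  proof -
    have "point s t \<in> aff_plus" using st by (simp add: half_plane_def)
    from killing_field_null_equations[OF K this] obtain DX where DX: "(X has_derivative DX) (at (point s t))"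
      and e: "(\<xi> (DX (point 1 0)) + \<eta> (DX (point 0 1))) * snd (point s t) = 2 * snd (X (point s t))" .
    have df: "(f has_real_derivative \<xi> (DX (point 1 0))) (at s)"
      by (rule has_field_derivative_transform_within_open[OF along(1)[OF bounded_linear_\<xi> DX] open_half_plane(1)[of t]])
        (use st f in auto)
    have dg: "(g has_real_derivative \<eta> (DX (point 0 1))) (at t)"
      by (rule has_field_derivative_transform_within_open[OF along(2)[OF bounded_linear_\<eta> DX] open_half_plane(2)[of s]])
        (use st g in auto)
    show ?thesis using df dg e snd_eq[of "X (point s t)"] f[OF st] g[OF st]
      by (simp add: DERIV_imp_deriv[OF df] DERIV_imp_deriv[OF dg] add.commute)
  qed
  show ?thesis
  proof (rule that)
    show "\<xi> (X p) = f (\<xi> p) \<and> \<eta> (X p) = g (\<eta> p)" if "p \<in> aff_plus" for p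
      using f[of "\<xi> p" "\<eta> p"] g[of "\<xi> p" "\<eta> p"] that by (simp add: half_plane_def in_aff_plus_iff)
    show "(f has_real_derivative deriv f s) (at s)" if "\<alpha> * t + \<beta> * s > 0" for s t
      using D[unfolded half_plane_def, OF that] by (rule conjunct1)
    show "(g has_real_derivative deriv g t) (at t)" if "\<alpha> * t + \<beta> * s > 0" for s t
      using D[unfolded half_plane_def, OF that] by (elim conjE)
    show "(deriv f s + deriv g t) * (\<alpha> * t + \<beta> * s) = 2 * (\<beta> * f s + \<alpha> * g t)"
      if "\<alpha> * t + \<beta> * s > 0" for s t
      using D[unfolded half_plane_def, OF that] by (elim conjE)
  qed
qed

text \<open>
  Along an integral curve the functional solves a Riccati equation, whose solutions with large
  initial value blow up in finite time.
\<close>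

lemma complete_field_component_affine:
  assumes X: "complete_field X" and L: "bounded_linear L"
    and quad: "\<And>p. p \<in> aff_plus \<Longrightarrow> L (X p) = q0 + q1 * L p + q2 * (L p)\<^sup>2"
    and unbounded: "\<And>R. \<exists>p\<in>aff_plus. R < \<bar>L p\<bar>"
  shows "q2 = (0::real)"
proof (rule ccontr)
  assume q2: "q2 \<noteq> 0"
  obtain p where p: "p \<in> aff_plus" "1 + 2 * (\<bar>q0\<bar> + \<bar>q1\<bar>) / \<bar>q2\<bar> < \<bar>L p\<bar>"
    using unbounded[of "1 + 2 * (\<bar>q0\<bar> + \<bar>q1\<bar>) / \<bar>q2\<bar>"] by (rule bexE)
  obtain \<gamma> where \<gamma>: "\<gamma> 0 = p" "\<And>t. \<gamma> t \<in> aff_plus" "\<And>t. (\<gamma> has_vector_derivative X (\<gamma> t)) (at t)"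
    using X p(1) unfolding complete_field_def by blast
  have "((\<lambda>t. L (\<gamma> t)) has_real_derivative q0 + q1 * L (\<gamma> t) + q2 * (L (\<gamma> t))\<^sup>2) (at t)" for t
    using bounded_linear.has_vector_derivative[OF L \<gamma>(3)[of t]] quad[OF \<gamma>(2)]
    by (simp add: has_real_derivative_iff_has_vector_derivative)
  from riccati_solution_blows_up[OF this q2] p(2) show False by (simp add: \<gamma>(1))
qed

text \<open>
  The null components of a Killing field are quadratic polynomials, affine by completeness, and
  then the Killing equation leaves exactly the two parameters of the right-invariant fields.
\<close>

theorem complete_killing_fields_eq: "complete_killing_fields A = field_span right_field1 right_field2"
proof
  show "field_span right_field1 right_field2 \<subseteq> complete_killing_fields A"
    using right_invariant_field_complete_killing by (auto simp: field_span_def)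
  show "complete_killing_fields A \<subseteq> field_span right_field1 right_field2"
  proof
    fix X assume "X \<in> complete_killing_fields A"
    then have ext: "X \<in> extensional aff_plus" and K: "killing_field A X" and comp: "complete_field X"
      by (auto simp: complete_killing_fields_def)
    obtain f g where fg: "\<And>p. p \<in> aff_plus \<Longrightarrow> \<xi> (X p) = f (\<xi> p) \<and> \<eta> (X p) = g (\<eta> p)"
      and df: "\<And>s t. \<alpha> * t + \<beta> * s > 0 \<Longrightarrow> (f has_real_derivative deriv f s) (at s)"
      and dg: "\<And>s t. \<alpha> * t + \<beta> * s > 0 \<Longrightarrow> (g has_real_derivative deriv g t) (at t)"
      and eq: "\<And>s t. \<alpha> * t + \<beta> * s > 0 \<Longrightarrow>
        (deriv f s + deriv g t) * (\<alpha> * t + \<beta> * s) = 2 * (\<beta> * f s + \<alpha> * g t)"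
      using killing_field_separates[OF K] by blast
    have ne': "\<beta> \<noteq> 0 \<or> \<alpha> \<noteq> 0" using \<alpha>_\<beta>_nonzero by blast
    have swap: "\<beta> * s + \<alpha> * t > 0 \<longleftrightarrow> \<alpha> * t + \<beta> * s > 0" for s t by (simp add: add.commute)
    obtain f0 f1 f2 where f: "\<And>s t. \<alpha> * t + \<beta> * s > 0 \<Longrightarrow> f s = f0 + f1 * s + f2 * s\<^sup>2"
      by (rule killing_component_quadratic[OF \<alpha>_\<beta>_nonzero, of f "deriv f" "deriv g" g])
        (erule df, erule eq, blast)
    have dg': "(g has_real_derivative deriv g t) (at t)" if "\<beta> * s + \<alpha> * t > 0" for s t
      using dg that unfolding swap by blast
    have eq': "(deriv g t + deriv f s) * (\<beta> * s + \<alpha> * t) = 2 * (\<alpha> * g t + \<beta> * f s)"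
      if "\<beta> * s + \<alpha> * t > 0" for s t
      using eq[of t s] that unfolding swap by (simp add: add.commute)
    obtain g0 g1 g2 where g: "\<And>t s. \<beta> * s + \<alpha> * t > 0 \<Longrightarrow> g t = g0 + g1 * t + g2 * t\<^sup>2"
      by (rule killing_component_quadratic[OF ne', of g "deriv g" "deriv f" f])
        (erule dg', erule eq', blast)
    note g = g[unfolded swap]
    have "f2 = 0"
    proof (rule complete_field_component_affine[OF comp bounded_linear_\<xi>])
      show "\<xi> (X p) = f0 + f1 * \<xi> p + f2 * (\<xi> p)\<^sup>2" if "p \<in> aff_plus" for p
        using fg[OF that] f that by (simp add: in_aff_plus_iff half_plane_def)
      show "\<exists>p\<in>aff_plus. R < \<bar>\<xi> p\<bar>" for R
        by (rule half_plane_unbounded[OF \<alpha>_\<beta>_nonzero, of R]) (metis half_plane_def point_in_aff_plus \<xi>_point)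
    qed
    have "g2 = 0"
    proof (rule complete_field_component_affine[OF comp bounded_linear_\<eta>])
      show "\<eta> (X p) = g0 + g1 * \<eta> p + g2 * (\<eta> p)\<^sup>2" if "p \<in> aff_plus" for p
        using fg[OF that] g that by (simp add: in_aff_plus_iff half_plane_def)
      show "\<exists>p\<in>aff_plus. R < \<bar>\<eta> p\<bar>" for R
        by (rule half_plane_unbounded[OF ne', of R]) (metis swap half_plane_def point_in_aff_plus \<eta>_point)
    qed
    note op = open_half_plane[unfolded half_plane_def]
    have f': "deriv f s = f1" if "\<alpha> * t + \<beta> * s > 0" for s t
    proof (rule DERIV_imp_deriv, rule has_field_derivative_transform_within_open[OF _ op(1)[of t]])
      show "((\<lambda>s. f0 + f1 * s) has_real_derivative f1) (at s)" by (auto intro!: derivative_eq_intros)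
    qed (use that f \<open>f2 = 0\<close> in auto)
    have g': "deriv g t = g1" if "\<alpha> * t + \<beta> * s > 0" for s t
    proof (rule DERIV_imp_deriv, rule has_field_derivative_transform_within_open[OF _ op(2)[of s]])
      show "((\<lambda>t. g0 + g1 * t) has_real_derivative g1) (at t)" by (auto intro!: derivative_eq_intros)
    qed (use that g \<open>g2 = 0\<close> in auto)
    have "(\<alpha> * (f1 - g1)) * t + (\<beta> * (g1 - f1)) * s + (- 2 * (\<alpha> * g0 + \<beta> * f0)) = 0"
      if st: "\<alpha> * t + \<beta> * s > 0" for s t
      using eq[OF st] unfolding f'[OF st] g'[OF st] f[OF st] g[OF st] \<open>f2 = 0\<close> \<open>g2 = 0\<close>
      by (simp add: algebra_simps)
    from affine_zero_on_half_plane[OF \<alpha>_\<beta>_nonzero this]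
    have 0: "\<alpha> * (f1 - g1) = 0" "\<beta> * (g1 - f1) = 0" "- 2 * (\<alpha> * g0 + \<beta> * f0) = 0" by blast+
    have slope: "f1 = g1" using 0(1,2) \<alpha>_\<beta>_nonzero by auto
    have h: "\<alpha> * g0 + \<beta> * f0 = 0" using 0(3) unfolding mult_eq_0_iff by simp
    have "X p = (\<lambda>q\<in>aff_plus. fst (point f0 g0) *\<^sub>R right_field1 q + f1 *\<^sub>R right_field2 q) p" for p
    proof (cases "p \<in> aff_plus")
      case True
      have "X p = point f0 g0 + f1 *\<^sub>R p"
        by (rule null_coords_inject)
          (use fg[OF True] f g True slope \<open>f2 = 0\<close> \<open>g2 = 0\<close> in \<open>auto simp: in_aff_plus_iff half_plane_def\<close>)
      also have "\<dots> = fst (point f0 g0) *\<^sub>R right_field1 p + f1 *\<^sub>R right_field2 p"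
        using h by (simp add: right_field1_def right_field2_def prod_eq_iff)
      finally show ?thesis using True by simp
    next
      case False
      then show ?thesis using extensional_arb[OF ext] by simp
    qed
    then show "X \<in> field_span right_field1 right_field2" unfolding field_span_def by blast
  qed
qed

end

section \<open>Complete Killing fields and isometries of the affine group\<close>

theorem proposition8:
  fixes A :: "real^2^2"
  assumes "det A > 0"
  shows "complete_killing_fields A = field_span right_field1 right_field2 \<and>
    isometries0 A = left_translation ` aff_plus \<and>
    lie_group_iso aff_group (top_of_set aff_plus)
      (isometry_group0 A) (subtopology (isometry_topology A) (isometries0 A))
      left_translation"
proof -
  interpret left_invariant_lorentzian A using assms by unfold_locales
  show ?thesis
    using complete_killing_fields_eq isometries0_eq left_translation_lie_group_iso by blast
qed

end
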